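(* If $\lambda_\theta\in\mathbb R$ is a degenerate eigenvalue of $\mathbf L(\theta)$ or $\widetilde{\mathbf L}(\vartheta)$, then $\lambda_\theta$ has multiplicity two. Conversely, if $K\le\lambda_\theta\in\rho(\mathbf L_0)$ and $\theta\in\mathcal M$, or $K\le\lambda_\theta\in\rho(\mathbf L_\infty)$ and $\vartheta\in\mathcal M$, and $\lambda_\theta$ is an eigenvalue of multiplicity two (of $\mathbf L(\theta)$, respectively $\widetilde{\mathbf L}(\vartheta)$), then $\lambda_\theta$ is degenerate.
   Context: Setting. Let $-\infty\le a<b\le\infty$, let $p,w>0$ a.e. and $q$ real-valued a.e. on $(a,b)$ with $1/p,q,w\in L^1_{\rm loc}((a,b),dx)$, and put $\ell[f]=-\frac1w\big((pf')'+qf\big)$, acting in $L^2[(a,b),w]$ with $\langle f,g\rangle=\int_a^b f\overline g\,w\,dx$. Let $\mathcal D_{\max}=\{f: f,pf'\in AC_{\rm loc}(a,b),\ f,\ell[f]\in L^2[(a,b),w]\}$ and $[f,g](x)=p(x)\big(f(x)\overline{g'(x)}-f'(x)\overline{g(x)}\big)$; for $f,g\in\mathcal D_{\max}$ the limits at the endpoints exist. Let $\mathcal D_{\min}=\{f\in\mathcal D_{\max}:[f,g](b)-[f,g](a)=0\ \forall g\in\mathcal D_{\max}\}$, and let $\mathbf L_{\max},\mathbf L_{\min}$ be $\ell$ with domains $\mathcal D_{\max},\mathcal D_{\min}$. Standing assumptions: both endpoints are limit-circle, and $\mathbf L_{\min}$ is semi-bounded from below with lower bound $K\in\mathbb R$: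 $\langle\mathbf L_{\min}f,f\rangle\ge K\langle f,f\rangle$ (so the endpoints are non-oscillating). Quasi-derivatives. Fix $\lambda_0\in\mathbb R$. A real solution $u$ of $(\ell-\lambda_0)y=0$ is principal (non-principal) at an endpoint if $1/(pu^2)$ is not integrable (is integrable) there. Let $u_a,v_a$ (resp. $u_b,v_b$) be real principal and non-principal solutions of $(\ell-\lambda_0)y=0$ at $a$ (resp. $b$) with $[u_a,v_a](a)=1$, $[u_b,v_b](b)=1$. For $f\in\mathcal D_{\max}$: $f^{[0]}(a)=[f,v_a](a)$, $f^{[1]}(a)=-[f,u_a](a)$, $f^{[0]}(b)=[f,v_b](b)$, $f^{[1]}(b)=-[f,u_b](b)$. For $\lambda\in\mathbb C$ let $u_1(\cdot,\lambda),u_2(\cdot,\lambda)$ be the solutions of $(\ell-\lambda)y=0$ with $u_1^{[0]}(a,\lambda)=1,\ u_1^{[1]}(a,\lambda)=0,\ u_2^{[0]}(a,\lambda)=0,\ u_2^{[1]}(a,\lambda)=1$; they satisfy $u_1^{[0]}(b,\lambda)u_2^{[1]}(b,\lambda)-u_1^{[1]}(b,\lambda)u_2^{[0]}(b,\lambda)=1$. Extensions. $\Gamma_0f=(f^{[0]}(a),f^{[0]}(b))^T$, $\Gamma_1f=(f^{[1]}(a),-f^{[1]}(b))^T$, $\Gamma_0'=-\Gamma_1$, $\Gamma_1'=\Gamma_0$. $\mathbf L_0$ and $\mathbf L_\infty$ are the restrictions of $\mathbf L_{\max}$ to $\ker\Gamma_0$ and $\ker\Gamma_1$. $\mathcal M$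 is the set of Hermitian $2\times2$ matrices and $\mathcal R\supset\mathcal M$ (matrices identified with graphs) the set of self-adjoint linear relations in $\mathbb C^2$. For $\theta\in\mathcal R$, $\mathbf L(\theta)$ is the restriction of $\mathbf L_{\max}$ to $\{f\in\mathcal D_{\max}:\{\Gamma_0f,\Gamma_1f\}\in\theta\}$ (for $\theta\in\mathcal M$: $\theta\Gamma_0f=\Gamma_1f$); for $\vartheta\in\mathcal R$, $\widetilde{\mathbf L}(\vartheta)$ is the restriction of $\mathbf L_{\max}$ to $\{f\in\mathcal D_{\max}:\{\Gamma_0'f,\Gamma_1'f\}\in\vartheta\}$. With $\vartheta=-\theta^{-1}$ (inverse as relation), $\widetilde{\mathbf L}(\vartheta)=\mathbf L(\theta)$. $\rho$ and $\sigma$ denote resolvent set and spectrum. Degeneracy. An eigenvalue $\lambda\in\mathbb R$ of $\mathbf L(\theta)$ (or $\widetilde{\mathbf L}(\vartheta)$) is called degenerate if one of the following holds: (i) $\lambda\in\rho(\mathbf L_0)$, $\theta\in\mathcal M$ and $\theta_{11}=-\frac{u_1^{[0]}(b,\lambda)}{u_2^{[0]}(b,\lambda)}$, $\theta_{21}=\frac1{u_2^{[0]}(b,\lambda)}$, $\theta_{22}=-\frac{u_2^{[1]}(b,\lambda)}{u_2^{[0]}(b,\lambda)}$; (ii) $\lambda\in\rho(\mathbf L_\infty)$, $\vartheta\in\mathcal M$ and $\vartheta_{11}=\frac{u_2^{[1]}(b,\lambda)}{u_1^{[1]}(b,\lambda)}$, $\vartheta_{21}=\frac1{u_1^{[1]}(b,\lambda)}$,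 $\vartheta_{22}=\frac{u_1^{[0]}(b,\lambda)}{u_1^{[1]}(b,\lambda)}$; (iii) $\lambda\in\sigma(\mathbf L_0)\cap\sigma(\mathbf L_\infty)$ and $\lambda$ has multiplicity two for $\mathbf L(\theta)$ (or $\widetilde{\mathbf L}(\vartheta)$). The denominators in (i) and (ii) are non-zero. *)

theory Defs
  imports "HOL-Analysis.Analysis" "HOL-Library.Function_Algebras"
begin

section \<open>The Sturm--Liouville expression\<close>

text \<open>
  The last six fields are the reference solutions of \<open>(\<ell> - \<lambda>\<^sub>0) y = 0\<close> that define the
  boundary values, and the two fundamental solutions of \<open>(\<ell> - z) y = 0\<close>, one pair
  for every \<open>z\<close>. What is required of them is stated in \<open>boundary_solutions\<close> and
  \<open>fundamental_solutions\<close> below.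
\<close>

record sl_expr =
  lend :: ereal
  rend :: ereal
  coeff_p :: "real \<Rightarrow> real"
  coeff_q :: "real \<Rightarrow> real"
  coeff_w :: "real \<Rightarrow> real"

record sl_system = sl_expr +
  lam0 :: real
  sol_ua :: "real \<Rightarrow> real"
  sol_va :: "real \<Rightarrow> real"
  sol_ub :: "real \<Rightarrow> real"
  sol_vb :: "real \<Rightarrow> real"
  sol_u1 :: "complex \<Rightarrow> real \<Rightarrow> complex"
  sol_u2 :: "complex \<Rightarrow> real \<Rightarrow> complex"

definition ivl :: "'z sl_expr_scheme \<Rightarrow> real set" where
  "ivl S = einterval (lend S) (rend S)"

definition L1_loc :: "'z sl_expr_scheme \<Rightarrow> (real \<Rightarrow> real) \<Rightarrow> bool" where
  "L1_loc S h \<longleftrightarrow> (\<forall>c\<in>ivl S. \<forall>d\<in>ivl S. c \<le> d \<longrightarrow> set_integrable lebesgue {c..d} h)"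

definition sl_coefficients :: "'z sl_expr_scheme \<Rightarrow> bool" where
  "sl_coefficients S \<longleftrightarrow>
     lend S < rend S \<and>
     (AE x in lebesgue. x \<in> ivl S \<longrightarrow> coeff_p S x > 0) \<and>
     (AE x in lebesgue. x \<in> ivl S \<longrightarrow> coeff_w S x > 0) \<and>
     L1_loc S (\<lambda>x. 1 / coeff_p S x) \<and> L1_loc S (coeff_q S) \<and> L1_loc S (coeff_w S)"

text \<open>The usual \<open>\<epsilon>\<close>-\<open>\<delta>\<close> definition. The finite families of non-overlapping compact intervals
  \<open>k = {Inf k..Sup k}\<close> are given as divisions of their union.\<close>

definition absolutely_continuous_on :: "real set \<Rightarrow> (real \<Rightarrow> complex) \<Rightarrow> bool" where
  "absolutely_continuous_on A f \<longleftrightarrow>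
     (\<forall>\<epsilon>>0. \<exists>\<delta>>0. \<forall>d T. d division_of T \<and> T \<subseteq> A \<and> (\<Sum>k\<in>d. Sup k - Inf k) < \<delta> \<longrightarrow>
        (\<Sum>k\<in>d. norm (f (Sup k) - f (Inf k))) < \<epsilon>)"

definition AC_loc :: "'z sl_expr_scheme \<Rightarrow> (real \<Rightarrow> complex) \<Rightarrow> bool" where
  "AC_loc S f \<longleftrightarrow>
     (\<forall>c\<in>ivl S. \<forall>d\<in>ivl S. c \<le> d \<longrightarrow> absolutely_continuous_on {c..d} f)"

text \<open>
  \<open>f'\<close> exists only almost everywhere, so \<open>p f'\<close> means its continuous representative
  \<open>pderiv_of S f\<close>, which is unique on the interval. In \<open>sl_regular\<close>, the almost everywhere
  differentiability of \<open>f\<close> and of \<open>p f'\<close> is automatic for functions in \<open>AC_loc\<close> by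
  Lebesgue's theorem; it is spelled out because that theorem is not in the library.
\<close>

definition is_pderiv :: "'z sl_expr_scheme \<Rightarrow> (real \<Rightarrow> complex) \<Rightarrow> (real \<Rightarrow> complex) \<Rightarrow> bool" where
  "is_pderiv S f F \<longleftrightarrow>
     AC_loc S F \<and>
     (AE x in lebesgue. x \<in> ivl S \<longrightarrow>
        (f has_vector_derivative F x / of_real (coeff_p S x)) (at x))"

definition pderiv_of :: "'z sl_expr_scheme \<Rightarrow> (real \<Rightarrow> complex) \<Rightarrow> real \<Rightarrow> complex" where
  "pderiv_of S f = (SOME F. is_pderiv S f F)"

definition sl_regular :: "'z sl_expr_scheme \<Rightarrow> (real \<Rightarrow> complex) \<Rightarrow> bool" where
  "sl_regular S f \<longleftrightarrow>
     AC_loc S f \<and> is_pderiv S f (pderiv_of S f) \<and>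
     (AE x in lebesgue. x \<in> ivl S \<longrightarrow> pderiv_of S f differentiable (at x))"

definition ell :: "'z sl_expr_scheme \<Rightarrow> (real \<Rightarrow> complex) \<Rightarrow> real \<Rightarrow> complex" where
  "ell S f x =
     - (1 / of_real (coeff_w S x)) *
       (vector_derivative (pderiv_of S f) (at x) + of_real (coeff_q S x) * f x)"

definition solution :: "'z sl_expr_scheme \<Rightarrow> complex \<Rightarrow> (real \<Rightarrow> complex) \<Rightarrow> bool" where
  "solution S z f \<longleftrightarrow>
     sl_regular S f \<and> (AE x in lebesgue. x \<in> ivl S \<longrightarrow> ell S f x = z * f x)"

section \<open>The maximal and minimal domains\<close>

definition L2 :: "'z sl_expr_scheme \<Rightarrow> (real \<Rightarrow> complex) set" where
  "L2 S = {f. set_borel_measurable lebesgue (ivl S) f \<and>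
              set_integrable lebesgue (ivl S) (\<lambda>x. (norm (f x))\<^sup>2 * coeff_w S x)}"

definition L2_inner ::
  "'z sl_expr_scheme \<Rightarrow> (real \<Rightarrow> complex) \<Rightarrow> (real \<Rightarrow> complex) \<Rightarrow> complex" where
  "L2_inner S f g = (LINT x:ivl S|lebesgue. f x * cnj (g x) * of_real (coeff_w S x))"

definition L2_norm :: "'z sl_expr_scheme \<Rightarrow> (real \<Rightarrow> complex) \<Rightarrow> real" where
  "L2_norm S f = sqrt (Re (L2_inner S f f))"

text \<open>A function on \<open>(a,b)\<close> that belongs to an operator domain is encoded by its extension by zero to
  the real line, so that it is determined by its restriction to \<open>(a,b)\<close>. Two
  continuous functions on \<open>(a,b)\<close> that agree almost everywhere are equal, hence the elements of
  \<open>Dmax S\<close> correspond exactly to elements of the Hilbert space.\<close>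

definition Dmax :: "'z sl_expr_scheme \<Rightarrow> (real \<Rightarrow> complex) set" where
  "Dmax S = {f. (\<forall>x. x \<notin> ivl S \<longrightarrow> f x = 0) \<and> sl_regular S f \<and> f \<in> L2 S \<and> ell S f \<in> L2 S}"

definition bracket ::
  "'z sl_expr_scheme \<Rightarrow> (real \<Rightarrow> complex) \<Rightarrow> (real \<Rightarrow> complex) \<Rightarrow> real \<Rightarrow> complex" where
  "bracket S f g x = f x * cnj (pderiv_of S g x) - pderiv_of S f x * cnj (g x)"

definition bracket_a ::
  "'z sl_expr_scheme \<Rightarrow> (real \<Rightarrow> complex) \<Rightarrow> (real \<Rightarrow> complex) \<Rightarrow> complex" where
  "bracket_a S f g = Lim (at_right (lend S)) (bracket S f g \<circ> real_of_ereal)"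

definition bracket_b ::
  "'z sl_expr_scheme \<Rightarrow> (real \<Rightarrow> complex) \<Rightarrow> (real \<Rightarrow> complex) \<Rightarrow> complex" where
  "bracket_b S f g = Lim (at_left (rend S)) (bracket S f g \<circ> real_of_ereal)"

definition Dmin :: "'z sl_expr_scheme \<Rightarrow> (real \<Rightarrow> complex) set" where
  "Dmin S = {f \<in> Dmax S. \<forall>g\<in>Dmax S. bracket_b S f g - bracket_a S f g = 0}"

text \<open>\<open>Re\<close> only serves to compare real numbers: the minimal operator is symmetric, so the left-hand
  inner product is real.\<close>

definition Lmin_bounded_below :: "'z sl_expr_scheme \<Rightarrow> real \<Rightarrow> bool" where
  "Lmin_bounded_below S K \<longleftrightarrow>
     (\<forall>f\<in>Dmin S. Re (L2_inner S (ell S f) f) \<ge> K * Re (L2_inner S f f))"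

definition integrable_near_a :: "'z sl_expr_scheme \<Rightarrow> (real \<Rightarrow> real) \<Rightarrow> bool" where
  "integrable_near_a S h \<longleftrightarrow> (\<exists>c\<in>ivl S. set_integrable lebesgue (einterval (lend S) (ereal c)) h)"

definition integrable_near_b :: "'z sl_expr_scheme \<Rightarrow> (real \<Rightarrow> real) \<Rightarrow> bool" where
  "integrable_near_b S h \<longleftrightarrow> (\<exists>c\<in>ivl S. set_integrable lebesgue (einterval (ereal c) (rend S)) h)"

definition limit_circle_a :: "'z sl_expr_scheme \<Rightarrow> bool" where
  "limit_circle_a S \<longleftrightarrow>
     (\<forall>z f. solution S z f \<longrightarrow> integrable_near_a S (\<lambda>x. (norm (f x))\<^sup>2 * coeff_w S x))"

definition limit_circle_b :: "'z sl_expr_scheme \<Rightarrow> bool" where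
  "limit_circle_b S \<longleftrightarrow>
     (\<forall>z f. solution S z f \<longrightarrow> integrable_near_b S (\<lambda>x. (norm (f x))\<^sup>2 * coeff_w S x))"

section \<open>Boundary values\<close>

abbreviation cfun :: "(real \<Rightarrow> real) \<Rightarrow> real \<Rightarrow> complex" where
  "cfun u \<equiv> (\<lambda>x. complex_of_real (u x))"

text \<open>Nontriviality is explicit because \<open>1 / 0 = 0\<close> would make the zero solution non-principal.\<close>

definition real_solution :: "'z sl_expr_scheme \<Rightarrow> real \<Rightarrow> (real \<Rightarrow> real) \<Rightarrow> bool" where
  "real_solution S \<mu> u \<longleftrightarrow> solution S (of_real \<mu>) (cfun u) \<and> (\<exists>x\<in>ivl S. u x \<noteq> 0)"

definition principal_a :: "'z sl_expr_scheme \<Rightarrow> real \<Rightarrow> (real \<Rightarrow> real) \<Rightarrow> bool" where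
  "principal_a S \<mu> u \<longleftrightarrow>
     real_solution S \<mu> u \<and> \<not> integrable_near_a S (\<lambda>x. 1 / (coeff_p S x * (u x)\<^sup>2))"

definition nonprincipal_a :: "'z sl_expr_scheme \<Rightarrow> real \<Rightarrow> (real \<Rightarrow> real) \<Rightarrow> bool" where
  "nonprincipal_a S \<mu> u \<longleftrightarrow>
     real_solution S \<mu> u \<and> integrable_near_a S (\<lambda>x. 1 / (coeff_p S x * (u x)\<^sup>2))"

definition principal_b :: "'z sl_expr_scheme \<Rightarrow> real \<Rightarrow> (real \<Rightarrow> real) \<Rightarrow> bool" where
  "principal_b S \<mu> u \<longleftrightarrow>
     real_solution S \<mu> u \<and> \<not> integrable_near_b S (\<lambda>x. 1 / (coeff_p S x * (u x)\<^sup>2))"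

definition nonprincipal_b :: "'z sl_expr_scheme \<Rightarrow> real \<Rightarrow> (real \<Rightarrow> real) \<Rightarrow> bool" where
  "nonprincipal_b S \<mu> u \<longleftrightarrow>
     real_solution S \<mu> u \<and> integrable_near_b S (\<lambda>x. 1 / (coeff_p S x * (u x)\<^sup>2))"

definition boundary_solutions :: "'z sl_system_scheme \<Rightarrow> bool" where
  "boundary_solutions S \<longleftrightarrow>
     principal_a S (lam0 S) (sol_ua S) \<and> nonprincipal_a S (lam0 S) (sol_va S) \<and>
     principal_b S (lam0 S) (sol_ub S) \<and> nonprincipal_b S (lam0 S) (sol_vb S) \<and>
     bracket_a S (cfun (sol_ua S)) (cfun (sol_va S)) = 1 \<and>
     bracket_b S (cfun (sol_ub S)) (cfun (sol_vb S)) = 1"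

text \<open>\<open>qd0_a S f\<close> and \<open>qd1_a S f\<close> are the boundary values \<open>f^[0](a)\<close> and \<open>f^[1](a)\<close>.\<close>

definition qd0_a :: "'z sl_system_scheme \<Rightarrow> (real \<Rightarrow> complex) \<Rightarrow> complex" where
  "qd0_a S f = bracket_a S f (cfun (sol_va S))"

definition qd1_a :: "'z sl_system_scheme \<Rightarrow> (real \<Rightarrow> complex) \<Rightarrow> complex" where
  "qd1_a S f = - bracket_a S f (cfun (sol_ua S))"

definition qd0_b :: "'z sl_system_scheme \<Rightarrow> (real \<Rightarrow> complex) \<Rightarrow> complex" where
  "qd0_b S f = bracket_b S f (cfun (sol_vb S))"

definition qd1_b :: "'z sl_system_scheme \<Rightarrow> (real \<Rightarrow> complex) \<Rightarrow> complex" where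
  "qd1_b S f = - bracket_b S f (cfun (sol_ub S))"

definition fundamental_solutions :: "'z sl_system_scheme \<Rightarrow> bool" where
  "fundamental_solutions S \<longleftrightarrow>
     (\<forall>z. solution S z (sol_u1 S z) \<and> qd0_a S (sol_u1 S z) = 1 \<and> qd1_a S (sol_u1 S z) = 0 \<and>
          solution S z (sol_u2 S z) \<and> qd0_a S (sol_u2 S z) = 0 \<and> qd1_a S (sol_u2 S z) = 1)"

definition \<Gamma>0 :: "'z sl_system_scheme \<Rightarrow> (real \<Rightarrow> complex) \<Rightarrow> complex^2" where
  "\<Gamma>0 S f = vector [qd0_a S f, qd0_b S f]"

definition \<Gamma>1 :: "'z sl_system_scheme \<Rightarrow> (real \<Rightarrow> complex) \<Rightarrow> complex^2" where
  "\<Gamma>1 S f = vector [qd1_a S f, - qd1_b S f]"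

definition \<Gamma>0' :: "'z sl_system_scheme \<Rightarrow> (real \<Rightarrow> complex) \<Rightarrow> complex^2" where
  "\<Gamma>0' S f = - \<Gamma>1 S f"

definition \<Gamma>1' :: "'z sl_system_scheme \<Rightarrow> (real \<Rightarrow> complex) \<Rightarrow> complex^2" where
  "\<Gamma>1' S f = \<Gamma>0 S f"

section \<open>Self-adjoint linear relations\<close>

type_synonym relation2 = "((complex^2) \<times> (complex^2)) set"

definition cdot :: "complex^2 \<Rightarrow> complex^2 \<Rightarrow> complex" where
  "cdot x y = (\<Sum>i\<in>UNIV. x $ i * cnj (y $ i))"

definition rel_adjoint :: "relation2 \<Rightarrow> relation2" where
  "rel_adjoint \<theta> = {(h, k). \<forall>(f, g)\<in>\<theta>. cdot g h = cdot f k}"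

text \<open>Linearity is implied, since an adjoint is always a linear subspace.\<close>

definition selfadjoint_relation :: "relation2 \<Rightarrow> bool" where
  "selfadjoint_relation \<theta> \<longleftrightarrow> rel_adjoint \<theta> = \<theta>"

definition hermitian_matrix :: "complex^2^2 \<Rightarrow> bool" where
  "hermitian_matrix M \<longleftrightarrow> (\<forall>i j. M $ i $ j = cnj (M $ j $ i))"

definition matrix_graph :: "complex^2^2 \<Rightarrow> relation2" where
  "matrix_graph M = {(x, M *v x) | x. True}"

definition is_hermitian_graph :: "relation2 \<Rightarrow> bool" where
  "is_hermitian_graph \<theta> \<longleftrightarrow> (\<exists>M. hermitian_matrix M \<and> \<theta> = matrix_graph M)"

definition neg_rel_inverse :: "relation2 \<Rightarrow> relation2" where
  "neg_rel_inverse \<theta> = {(y, - x) | x y. (x, y) \<in> \<theta>}"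

section \<open>Extensions, spectra and multiplicities\<close>

text \<open>All operators are restrictions of \<open>ell S\<close>, so each one is represented by its domain
  \<open>D \<subseteq> Dmax S\<close>.\<close>

definition dom_L0 :: "'z sl_system_scheme \<Rightarrow> (real \<Rightarrow> complex) set" where
  "dom_L0 S = {f \<in> Dmax S. \<Gamma>0 S f = 0}"

definition dom_Linf :: "'z sl_system_scheme \<Rightarrow> (real \<Rightarrow> complex) set" where
  "dom_Linf S = {f \<in> Dmax S. \<Gamma>1 S f = 0}"

definition dom_L :: "'z sl_system_scheme \<Rightarrow> relation2 \<Rightarrow> (real \<Rightarrow> complex) set" where
  "dom_L S \<theta> = {f \<in> Dmax S. (\<Gamma>0 S f, \<Gamma>1 S f) \<in> \<theta>}"

definition dom_Ltilde :: "'z sl_system_scheme \<Rightarrow> relation2 \<Rightarrow> (real \<Rightarrow> complex) set" where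
  "dom_Ltilde S \<theta>' = {f \<in> Dmax S. (\<Gamma>0' S f, \<Gamma>1' S f) \<in> \<theta>'}"

definition eigenspace ::
  "'z sl_expr_scheme \<Rightarrow> (real \<Rightarrow> complex) set \<Rightarrow> complex \<Rightarrow> (real \<Rightarrow> complex) set" where
  "eigenspace S D z = {f \<in> D. AE x in lebesgue. x \<in> ivl S \<longrightarrow> ell S f x = z * f x}"

definition eigenvalue :: "'z sl_expr_scheme \<Rightarrow> (real \<Rightarrow> complex) set \<Rightarrow> complex \<Rightarrow> bool" where
  "eigenvalue S D z \<longleftrightarrow> (\<exists>f\<in>eigenspace S D z. f \<noteq> 0)"

interpretation fun_space: vector_space "\<lambda>(c::complex) (f::real \<Rightarrow> complex) x. c * f x"
  by unfold_locales (auto simp: fun_eq_iff algebra_simps)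

definition multiplicity_of ::
  "'z sl_expr_scheme \<Rightarrow> (real \<Rightarrow> complex) set \<Rightarrow> complex \<Rightarrow> nat" where
  "multiplicity_of S D z = fun_space.dim (eigenspace S D z)"

text \<open>\<open>z\<close> is in the resolvent set iff \<open>\<ell> - z\<close>, restricted to \<open>D\<close>, is a bijection
  onto \<open>L\<^sup>2\<close> (whose elements are functions modulo almost everywhere equality) with
  bounded inverse.\<close>

definition resolvent_set :: "'z sl_expr_scheme \<Rightarrow> (real \<Rightarrow> complex) set \<Rightarrow> complex set" where
  "resolvent_set S D = {z.
     (\<forall>g\<in>L2 S. \<exists>!f. f \<in> D \<and> (AE x in lebesgue. x \<in> ivl S \<longrightarrow> ell S f x - z * f x = g x)) \<and>
     (\<exists>C. \<forall>f\<in>D. L2_norm S f \<le> C * L2_norm S (\<lambda>x. ell S f x - z * f x))}"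

definition spectrum_of :: "'z sl_expr_scheme \<Rightarrow> (real \<Rightarrow> complex) set \<Rightarrow> complex set" where
  "spectrum_of S D = - resolvent_set S D"

section \<open>Degenerate eigenvalues\<close>

definition degenerate_i :: "'z sl_system_scheme \<Rightarrow> relation2 \<Rightarrow> complex \<Rightarrow> bool" where
  "degenerate_i S \<theta> z \<longleftrightarrow>
     z \<in> resolvent_set S (dom_L0 S) \<and>
     (\<exists>M. hermitian_matrix M \<and> \<theta> = matrix_graph M \<and>
        M $ 1 $ 1 = - (qd0_b S (sol_u1 S z) / qd0_b S (sol_u2 S z)) \<and>
        M $ 2 $ 1 = 1 / qd0_b S (sol_u2 S z) \<and>
        M $ 2 $ 2 = - (qd1_b S (sol_u2 S z) / qd0_b S (sol_u2 S z)))"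

definition degenerate_ii :: "'z sl_system_scheme \<Rightarrow> relation2 \<Rightarrow> complex \<Rightarrow> bool" where
  "degenerate_ii S \<theta>' z \<longleftrightarrow>
     z \<in> resolvent_set S (dom_Linf S) \<and>
     (\<exists>M. hermitian_matrix M \<and> \<theta>' = matrix_graph M \<and>
        M $ 1 $ 1 = qd1_b S (sol_u2 S z) / qd1_b S (sol_u1 S z) \<and>
        M $ 2 $ 1 = 1 / qd1_b S (sol_u1 S z) \<and>
        M $ 2 $ 2 = qd0_b S (sol_u1 S z) / qd1_b S (sol_u1 S z))"

text \<open>\<open>D\<close> is the domain of the operator under consideration, \<open>dom_L S \<theta>\<close> or
  \<open>dom_Ltilde S \<theta>'\<close>, where \<open>\<theta>' = neg_rel_inverse \<theta>\<close>.\<close>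

definition degenerate ::
  "'z sl_system_scheme \<Rightarrow> (real \<Rightarrow> complex) set \<Rightarrow> relation2 \<Rightarrow> relation2 \<Rightarrow> real \<Rightarrow> bool" where
  "degenerate S D \<theta> \<theta>' \<mu> \<longleftrightarrow>
     eigenvalue S D (of_real \<mu>) \<and>
     (degenerate_i S \<theta> (of_real \<mu>) \<or>
      degenerate_ii S \<theta>' (of_real \<mu>) \<or>
      (of_real \<mu> \<in> spectrum_of S (dom_L0 S) \<inter> spectrum_of S (dom_Linf S) \<and>
       multiplicity_of S D (of_real \<mu>) = 2))"

end

theory Submission
  imports Defs
begin

text \<open>
  Two solutions \<open>f\<close>, \<open>g\<close> of \<open>(\<ell> - z) y = 0\<close> have a constant Wronskian, and the limit of the Pluecker
  relation at an endpoint, where \<open>[u, v] = 1\<close>, expresses it by the boundary values: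
  \<open>W(f, g) = f^[0] g^[1] - f^[1] g^[0]\<close>. Hence \<open>W(u\<^sub>1, u\<^sub>2) = 1\<close>, and every solution is
  \<open>W(f, u\<^sub>2) u\<^sub>1 + W(u\<^sub>1, f) u\<^sub>2\<close>, so that no existence or uniqueness theorem for the differential
  equation is needed. By the limit-circle condition the eigenspace of an extension is the set of those
  combinations of \<open>u\<^sub>1\<close> and \<open>u\<^sub>2\<close> that satisfy the boundary condition. It has dimension two iff \<open>u\<^sub>1\<close>
  and \<open>u\<^sub>2\<close> both satisfy it, and for a matrix this is a linear system with the entries in (i)
  or (ii) as its only solution.
\<close>

section \<open>Absolutely continuous functions\<close>

text \<open>Solutions are differentiable only almost everywhere, and a continuous function with
  derivative zero almost everywhere may still increase. Absolute continuity excludes this, so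
  constancy of Wronskians rests on a fundamental theorem of calculus for absolutely continuous
  functions, obtained with gauges. For two spectral parameters z and \<zeta> the same theorem gives
  W' = (z - \<zeta>) f g w, integrable near a limit-circle endpoint. With \<zeta> =
  \<open>lam0 S\<close> this makes the boundary values of a solution, defined through
  \<open>Lim\<close>, genuine limits and hence linear in the solution. The boundary form is
  sesquilinear and the Wronskian bilinear; they agree because the reference solutions are real. The
  conditions (i) and (ii) prescribe three entries of a matrix. The fourth follows from Hermitian
  symmetry once the denominators are known to be real for real \<mu>, which is the purpose of the
  facts on conjugation. The denominators are non-zero because otherwise u_2 would be an
  eigenfunction of L_0, or u_1 one of L_\<infinity>, at a point of the resolvent set.\<close>

lemma division_memE_real:
  fixes k :: "real set"
  assumes "d division_of T" "k \<in> d"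
  obtains u v where "k = {u..v}" "u \<le> v" "{u..v} \<subseteq> T" "Sup k = v" "Inf k = u"
proof -
  obtain u v where uv: "k = cbox u v" and "k \<noteq> {}" "k \<subseteq> T"
    using assms unfolding division_of_def by metis
  then have "u \<le> v" "k = {u..v}" "{u..v} \<subseteq> T" by auto
  then show ?thesis using that by auto
qed

text \<open>One criterion for all closure properties: linear combinations, products, conjugates, and
  changes of values outside the interval each have increments dominated in this way.\<close>

lemma absolutely_continuous_on_dominated:
  assumes f: "absolutely_continuous_on A f" and g: "absolutely_continuous_on A g"
    and h: "\<And>x y. x \<in> A \<Longrightarrow> y \<in> A \<Longrightarrow> norm (h y - h x) \<le> C * (norm (f y - f x) + norm (g y - g x))"
  shows "absolutely_continuous_on A h"
  unfolding absolutely_continuous_on_def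
proof (intro allI impI)
  fix \<epsilon> :: real assume "\<epsilon> > 0"
  \<comment> \<open>\<open>C\<close> may be zero or negative, whereas
    \<open>\<epsilon> / (2*c)\<close> needs a positive constant.\<close>
  define c where "c = max C 1"
  have c: "c > 0" "C \<le> c" by (auto simp: c_def)
  have "\<epsilon> / (2*c) > 0" using c \<open>\<epsilon> > 0\<close> by simp
  obtain \<delta>1 where d1: "\<delta>1 > 0" "\<forall>d T. d division_of T \<and> T \<subseteq> A \<and> (\<Sum>k\<in>d. Sup k - Inf k) < \<delta>1 \<longrightarrow>
        (\<Sum>k\<in>d. norm (f (Sup k) - f (Inf k))) < \<epsilon> / (2*c)"
    using f[unfolded absolutely_continuous_on_def, rule_format, OF \<open>\<epsilon> / (2*c) > 0\<close>] by (elim exE conjE)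
  obtain \<delta>2 where d2: "\<delta>2 > 0" "\<forall>d T. d division_of T \<and> T \<subseteq> A \<and> (\<Sum>k\<in>d. Sup k - Inf k) < \<delta>2 \<longrightarrow>
        (\<Sum>k\<in>d. norm (g (Sup k) - g (Inf k))) < \<epsilon> / (2*c)"
    using g[unfolded absolutely_continuous_on_def, rule_format, OF \<open>\<epsilon> / (2*c) > 0\<close>] by (elim exE conjE)
  have "(\<Sum>k\<in>d. norm (h (Sup k) - h (Inf k))) < \<epsilon>"
    if d: "d division_of T" "T \<subseteq> A" and s: "(\<Sum>k\<in>d. Sup k - Inf k) < min \<delta>1 \<delta>2" for d T
  proof -
    have "(\<Sum>k\<in>d. norm (h (Sup k) - h (Inf k)))
        \<le> (\<Sum>k\<in>d. c * (norm (f (Sup k) - f (Inf k)) + norm (g (Sup k) - g (Inf k))))"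
    proof (rule sum_mono)
      fix k assume "k \<in> d"
      then obtain u v where "k = {u..v}" "u \<le> v" "{u..v} \<subseteq> T" "Sup k = v" "Inf k = u"
        using division_memE_real[OF d(1)] by metis
      then have "Sup k \<in> A" "Inf k \<in> A" using d(2) by auto
      then have "norm (h (Sup k) - h (Inf k))
          \<le> C * (norm (f (Sup k) - f (Inf k)) + norm (g (Sup k) - g (Inf k)))" by (rule h[rotated])
      also have "\<dots> \<le> c * (norm (f (Sup k) - f (Inf k)) + norm (g (Sup k) - g (Inf k)))"
        using c by (intro mult_right_mono) auto
      finally show "norm (h (Sup k) - h (Inf k))
          \<le> c * (norm (f (Sup k) - f (Inf k)) + norm (g (Sup k) - g (Inf k)))" .
    qed
    also have "\<dots> = c * (\<Sum>k\<in>d. norm (f (Sup k) - f (Inf k))) + c * (\<Sum>k\<in>d. norm (g (Sup k) - g (Inf k)))"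
      by (simp add: sum_distrib_left sum.distrib distrib_left)
    also have "\<dots> < c * (\<epsilon> / (2*c)) + c * (\<epsilon> / (2*c))"
      using c d1(2)[rule_format, of d T] d2(2)[rule_format, of d T] d s by (intro add_strict_mono mult_strict_left_mono) auto
    also have "\<dots> = \<epsilon>" using c by simp
    finally show ?thesis .
  qed
  then show "\<exists>\<delta>>0. \<forall>d T. d division_of T \<and> T \<subseteq> A \<and> (\<Sum>k\<in>d. Sup k - Inf k) < \<delta> \<longrightarrow>
        (\<Sum>k\<in>d. norm (h (Sup k) - h (Inf k))) < \<epsilon>"
    using d1(1) d2(1) by (intro exI[of _ "min \<delta>1 \<delta>2"]) auto
qed

lemma absolutely_continuous_on_imp_continuous_on:
  assumes "absolutely_continuous_on {c..d} f"
  shows "continuous_on {c..d} f"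
  unfolding continuous_on_iff
proof (intro ballI allI impI)
  fix x e :: real assume x: "x \<in> {c..d}" and "e > 0"
  obtain \<delta> where \<delta>: "\<delta> > 0" "\<forall>D T. D division_of T \<and> T \<subseteq> {c..d} \<and> (\<Sum>k\<in>D. Sup k - Inf k) < \<delta> \<longrightarrow>
        (\<Sum>k\<in>D. norm (f (Sup k) - f (Inf k))) < e"
    using assms[unfolded absolutely_continuous_on_def, rule_format, OF \<open>e > 0\<close>] by (elim exE conjE)
  have "dist (f y) (f x) < e" if y: "y \<in> {c..d}" "dist y x < \<delta>" for y
  proof -
    \<comment> \<open>The definition is applied to the division with the single interval between
      \<open>x\<close> and \<open>y\<close>, whichever of them comes first.\<close>
    define u v where "u = min x y" and "v = max x y"
    have uv: "u \<le> v" "v - u < \<delta>" "{u..v} \<subseteq> {c..d}"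
      using x y by (auto simp: u_def v_def dist_real_def)
    have "{{u..v}} division_of {u..v}" using division_of_self[of u v] uv(1) by simp
    moreover have "(\<Sum>k\<in>{{u..v}}. Sup k - Inf k) < \<delta>" using uv by simp
    ultimately have "(\<Sum>k\<in>{{u..v}}. norm (f (Sup k) - f (Inf k))) < e"
      using uv(3) \<delta>(2) by blast
    then have "norm (f v - f u) < e" using uv(1) by simp
    then show ?thesis
      by (auto simp: u_def v_def dist_norm max_def min_def norm_minus_commute split: if_splits)
  qed
  then show "\<exists>\<delta>>0. \<forall>y\<in>{c..d}. dist y x < \<delta> \<longrightarrow> dist (f y) (f x) < e"
    using \<delta>(1) by blast
qed

lemma absolutely_continuous_on_mult:
  assumes f: "absolutely_continuous_on {c..d} f" and g: "absolutely_continuous_on {c..d} g"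
  shows "absolutely_continuous_on {c..d} (\<lambda>x. f x * g x)"
proof -
  have "bounded (f ` {c..d})" "bounded (g ` {c..d})"
    using f g by (auto intro!: compact_imp_bounded compact_continuous_image
        absolutely_continuous_on_imp_continuous_on)
  then obtain M N where M: "\<And>x. x \<in> {c..d} \<Longrightarrow> norm (f x) \<le> M" and N: "\<And>x. x \<in> {c..d} \<Longrightarrow> norm (g x) \<le> N"
    unfolding bounded_iff by (metis imageI)
  show ?thesis
  proof (rule absolutely_continuous_on_dominated[OF f g])
    fix x y assume xy: "x \<in> {c..d}" "y \<in> {c..d}"
    have "f y * g y - f x * g x = (f y - f x) * g y + f x * (g y - g x)" by (simp add: algebra_simps)
    then have "norm (f y * g y - f x * g x) \<le> norm (f y - f x) * norm (g y) + norm (f x) * norm (g y - g x)"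
      by (metis norm_mult norm_triangle_ineq)
    also have "\<dots> \<le> norm (f y - f x) * max M N + max M N * norm (g y - g x)"
      using M[OF xy(1)] N[OF xy(2)] by (intro add_mono mult_left_mono mult_right_mono) auto
    finally show "norm (f y * g y - f x * g x) \<le> max M N * (norm (f y - f x) + norm (g y - g x))"
      by (simp add: algebra_simps)
  qed
qed

text \<open>Henstock's argument. With the integrand set to 0 on \<open>N\<close>, a tag in
  \<open>N\<close> contributes only the increment of \<open>f\<close>; the gauge confines its
  interval to an open set of measure below \<open>\<delta>\<close>, so absolute continuity bounds
  these increments by \<open>e/2\<close>. At the other tags differentiability makes each error at
  most a small multiple of the length.\<close>

theorem fundamental_theorem_of_calculus_absolutely_continuous:
  assumes cd: "c \<le> d" and ac: "absolutely_continuous_on {c..d} f"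
    and N: "negligible N"
    and der: "\<And>x. x \<in> {c..d} - N \<Longrightarrow> (f has_vector_derivative f' x) (at x within {c..d})"
  shows "(f' has_integral f d - f c) {c..d}"
proof -
  define g where "g x = (if x \<in> N then 0 else f' x)" for x
  have "(g has_integral f d - f c) {c..d}"
    unfolding has_integral_real
  proof (intro allI impI)
    fix e :: real assume "e > 0"
    obtain \<delta> where \<delta>: "\<delta> > 0" "\<forall>D T. D division_of T \<and> T \<subseteq> {c..d} \<and> (\<Sum>k\<in>D. Sup k - Inf k) < \<delta> \<longrightarrow>
        (\<Sum>k\<in>D. norm (f (Sup k) - f (Inf k))) < e/2"
      using ac[unfolded absolutely_continuous_on_def, rule_format, OF half_gt_zero[OF \<open>e > 0\<close>]] by (elim exE conjE)
    have N0: "N \<in> null_sets lebesgue" using N by (simp add: negligible_iff_null_sets)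
    then obtain U where U: "open U" "N \<subseteq> U" "U - N \<in> lmeasurable" "emeasure lebesgue (U - N) < ennreal \<delta>"
      using sets_lebesgue_outer_open[OF null_setsD2[OF N0] \<delta>(1)] by metis
    have Ul: "emeasure lebesgue U < ennreal \<delta>"
      using U emeasure_Diff_null_set[OF N0, of U] by (simp add: borel_open)
    then have Um1: "U \<in> lmeasurable"
      using U(1) by (auto intro!: fmeasurableI simp: borel_open dest: order.strict_trans[OF _ ennreal_less_top])
    have Um2: "measure lebesgue U < \<delta>"
      using Ul \<delta>(1) unfolding emeasure_eq_measure2[OF Um1] by (simp add: ennreal_less_iff)
    \<comment> \<open>The errors at tags outside \<open>N\<close> add up to at most
      \<open>2 * \<eta> * (d - c)\<close>, which is then at most \<open>e/2\<close>; the
      \<open>+ 1\<close> covers \<open>c = d\<close>.\<close>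
    define \<eta> where "\<eta> = e / (4 * (d - c + 1))"
    have \<eta>: "\<eta> > 0" "\<eta> * (d - c) \<le> e/4"
      using \<open>e > 0\<close> cd by (auto simp: \<eta>_def divide_simps)
    have "\<exists>r>0. \<forall>y\<in>{c..d}. norm (y - x) < r \<longrightarrow> norm (f y - f x - (y - x) *\<^sub>R f' x) \<le> \<eta> * norm (y - x)"
      if "x \<in> {c..d} - N" for x
      using der[OF that] \<eta>(1) unfolding has_vector_derivative_def has_derivative_within_alt by blast
    then obtain r where r: "\<And>x. x \<in> {c..d} - N \<Longrightarrow> r x > 0"
      "\<And>x y. x \<in> {c..d} - N \<Longrightarrow> y \<in> {c..d} \<Longrightarrow> norm (y - x) < r x \<Longrightarrow>
         norm (f y - f x - (y - x) *\<^sub>R f' x) \<le> \<eta> * norm (y - x)"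
      by metis
    \<comment> \<open>A gauge must be an open neighbourhood of every real number, so points outside
      \<open>{c..d}\<close> get an arbitrary ball.\<close>
    define \<gamma> where "\<gamma> x = (if x \<in> N then U else if x \<in> {c..d} then ball x (r x) else ball x 1)" for x
    have "gauge \<gamma>"
      using U r(1) by (auto simp: gauge_def \<gamma>_def)
    moreover have "norm ((\<Sum>(x, k)\<in>p. measure lborel k *\<^sub>R g x) - (f d - f c)) < e"
      if p: "p tagged_division_of {c..d}" "\<gamma> fine p" for p
    proof -
      have fin: "finite p" using p(1) by blast
      define p1 where "p1 = {(x,k)\<in>p. x \<in> N}"
      have p1: "p1 \<subseteq> p" "finite p1" using fin by (auto simp: p1_def intro: finite_subset[OF _ fin])
      define D where "D = (\<lambda>(x::real,k). norm (measure lborel k *\<^sub>R g x - (f (Sup k) - f (Inf k))))"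
      have mem: "\<exists>u v. k = {u..v} \<and> u \<le> v \<and> x \<in> {u..v} \<and> {u..v} \<subseteq> {c..d} \<and> Sup k = v \<and> Inf k = u \<and> measure lborel k = v - u"
        if xk: "(x,k) \<in> p" for x k
      proof -
        obtain u v where k: "k = cbox u v" using tagged_division_ofD(4)[OF p(1) xk] by auto
        have x: "x \<in> k" "k \<subseteq> {c..d}"
          using tagged_division_ofD(2,3)[OF p(1) xk] by auto
        then have "u \<le> v" using k by simp
        with x k show ?thesis by (intro exI[of _ u] exI[of _ v]) simp
      qed
      have snd_mem: "k \<noteq> {}" "measure lebesgue k = Sup k - Inf k" if "k \<in> snd ` p1" for k
      proof -
        from that obtain x where "(x,k) \<in> p" using p1(1) by auto
        then obtain u v where "k = {u..v}" "u \<le> v" using mem by blast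
        then show "k \<noteq> {}" "measure lebesgue k = Sup k - Inf k" by simp_all
      qed
      have "(\<Sum>(x, k)\<in>p. measure lborel k *\<^sub>R g x) - (f d - f c)
          = (\<Sum>(x, k)\<in>p. measure lborel k *\<^sub>R g x - (f (Sup k) - f (Inf k)))"
        using additive_tagged_division_1[OF cd p(1), of f] by (simp add: sum_subtractf case_prod_unfold)
      then have "norm ((\<Sum>(x, k)\<in>p. measure lborel k *\<^sub>R g x) - (f d - f c)) \<le> sum D p"
        unfolding D_def case_prod_unfold by (simp only: norm_sum)
      also have "sum D p = sum D p1 + sum D (p - p1)"
        using sum.subset_diff[OF p1(1) fin, of D] by simp
      finally have split: "norm ((\<Sum>(x, k)\<in>p. measure lborel k *\<^sub>R g x) - (f d - f c)) \<le> sum D p1 + sum D (p - p1)" .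
      have "sum D p1 < e/2"
      proof -
        have part: "p1 tagged_partial_division_of {c..d}"
          using tagged_partial_division_subset[OF conjunct1[OF p(1)[unfolded tagged_division_of_def]] p1(1)] .
        have div: "snd ` p1 division_of \<Union>(snd ` p1)"
          by (rule partial_division_of_tagged_division[OF part])
        have eq: "sum D p1 = (\<Sum>k\<in>snd ` p1. norm (f (Sup k) - f (Inf k)))"
        proof -
          have "sum D p1 = (\<Sum>(x,k)\<in>p1. norm (f (Sup k) - f (Inf k)))"
            by (rule sum.cong) (auto simp: D_def p1_def g_def norm_minus_commute)
          \<comment> \<open>Dropping the tags can only merge degenerate intervals, whose increment
            is 0. The rule asks for the value 0 on empty boxes too, where \<open>Sup\<close> and
            \<open>Inf\<close> carry no meaning; hence the case distinction.\<close>
          also have "\<dots> = (\<Sum>k\<in>snd ` p1. if k = {} then 0 else norm (f (Sup k) - f (Inf k)))"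
          proof -
            have "(\<Sum>(x,k)\<in>p1. norm (f (Sup k) - f (Inf k))) = (\<Sum>(x,k)\<in>p1. if k = {} then 0 else norm (f (Sup k) - f (Inf k)))"
              using snd_mem(1) by (intro sum.cong) force+
            also have "\<dots> = (\<Sum>k\<in>snd ` p1. if k = {} then 0 else norm (f (Sup k) - f (Inf k)))"
              by (rule sum.over_tagged_division_lemma[OF tagged_partial_division_of_Union_self[OF part]])
                (auto simp: box_eq_empty not_less)
            finally show ?thesis .
          qed
          also have "\<dots> = (\<Sum>k\<in>snd ` p1. norm (f (Sup k) - f (Inf k)))"
            using snd_mem(1) by (intro sum.cong) auto
          finally show ?thesis .
        qed
        have "k \<subseteq> {c..d} \<and> k \<subseteq> U" if "k \<in> snd ` p1" for k
        proof -
          from that obtain x where xk: "(x,k) \<in> p" "x \<in> N" by (auto simp: p1_def)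
          then show ?thesis
            using tagged_division_ofD(3)[OF p(1) xk(1)] fineD[OF p(2) xk(1)] by (simp add: \<gamma>_def)
        qed
        then have sub: "\<Union>(snd ` p1) \<subseteq> {c..d}" "\<Union>(snd ` p1) \<subseteq> U" by blast+
        have "(\<Sum>k\<in>snd ` p1. Sup k - Inf k) = (\<Sum>k\<in>snd ` p1. measure lebesgue k)"
          using snd_mem(2) by (intro sum.cong) auto
        also have "\<dots> = measure lebesgue (\<Union>(snd ` p1))"
          using content_division[OF div] by simp
        also have "\<dots> \<le> measure lebesgue U"
          using sub(2) Um1 lmeasurable_division[OF div] by (intro measure_mono_fmeasurable) auto
        also have "\<dots> < \<delta>" by (rule Um2)
        finally show ?thesis using \<delta>(2)[rule_format, OF conjI[OF div conjI[OF sub(1)]]] eq by simp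
      qed
      have "sum D (p - p1) \<le> (\<Sum>(x,k)\<in>p - p1. 2 * \<eta> * measure lborel k)"
      proof (rule sum_mono, clarify)
        fix x k assume xk: "(x,k) \<in> p" "(x,k) \<notin> p1"
        then obtain u v where k: "k = {u..v}" "u \<le> v" "x \<in> {u..v}" "{u..v} \<subseteq> {c..d}" "Sup k = v" "Inf k = u" "measure lborel k = v - u"
          using mem by metis
        have x: "x \<in> {c..d} - N" using xk k by (auto simp: p1_def)
        then have "k \<subseteq> ball x (r x)" using p(2) xk by (fastforce simp: fine_def \<gamma>_def)
        then have "norm (v - x) < r x" "norm (u - x) < r x" using k(1,2) by (auto simp: dist_real_def)
        then have 1: "norm (f v - f x - (v - x) *\<^sub>R f' x) \<le> \<eta> * norm (v - x)"
          "norm (f u - f x - (u - x) *\<^sub>R f' x) \<le> \<eta> * norm (u - x)"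
          using k(2-4) r(2)[OF x, of v] r(2)[OF x, of u] by auto
        \<comment> \<open>Straddle estimate: the increment over \<open>{u..v}\<close> is split at
          the tag, and both \<open>v - x\<close> and \<open>x - u\<close> are at most the
          length.\<close>
        have "D (x,k) = norm ((f v - f x - (v - x) *\<^sub>R f' x) - (f u - f x - (u - x) *\<^sub>R f' x))"
          using x k by (subst norm_minus_commute) (simp add: D_def g_def algebra_simps)
        also have "\<dots> \<le> \<eta> * norm (v - x) + \<eta> * norm (u - x)"
          by (rule order_trans[OF norm_triangle_ineq4 add_mono[OF 1]])
        also have "\<dots> \<le> 2 * \<eta> * measure lborel k" using k \<eta>(1) mult_left_mono[of "v-x" "v-u" \<eta>] mult_left_mono[of "x-u" "v-u" \<eta>]
          by (simp add: algebra_simps)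
        finally show "D (x,k) \<le> 2 * \<eta> * measure lborel k" .
      qed
      also have "\<dots> \<le> (\<Sum>(x,k)\<in>p. 2 * \<eta> * measure lborel k)"
        using fin \<eta>(1) by (intro sum_mono2) auto
      also have "\<dots> = 2 * \<eta> * (d - c)"
        using additive_content_tagged_division[of p c d] p(1) cd
        by (simp add: case_prod_unfold sum_distrib_left[symmetric])
      finally have "sum D (p - p1) \<le> e/2" using \<eta>(2) by simp
      with split show ?thesis using \<open>sum D p1 < e/2\<close> by simp
    qed
    ultimately show "\<exists>\<gamma>. gauge \<gamma> \<and> (\<forall>p. p tagged_division_of {c..d} \<and> \<gamma> fine p \<longrightarrow>
        norm ((\<Sum>(x, k)\<in>p. measure lborel k *\<^sub>R g x) - (f d - f c)) < e)"
      by (intro exI[of _ \<gamma>] conjI allI impI) simp_all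
  qed
  from has_integral_spike[OF N _ this] show ?thesis by (simp add: g_def)
qed

section \<open>Solutions and Wronskians\<close>

lemma open_ivl: "open (ivl S)"
  by (simp add: ivl_def open_einterval)

lemma atLeastAtMost_subset_ivl:
  assumes "c \<in> ivl S" "d \<in> ivl S"
  shows "{c..d} \<subseteq> ivl S"
proof
  fix x assume "x \<in> {c..d}"
  then have "ereal c \<le> ereal x" "ereal x \<le> ereal d" by auto
  with assms show "x \<in> ivl S"
    unfolding ivl_def einterval_def by (auto intro: less_le_trans[of _ "ereal c"] le_less_trans[of _ "ereal d"])
qed

lemma ivl_compact_nbhd:
  assumes "x \<in> ivl S"
  obtains c d where "c \<in> ivl S" "d \<in> ivl S" "c < x" "x < d"
proof -
  obtain e where e: "e > 0" "cball x e \<subseteq> ivl S"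
    using open_ivl assms open_contains_cball by blast
  then have "x - e \<in> ivl S" "x + e \<in> ivl S" by (auto simp: subset_iff dist_real_def)
  with e(1) show ?thesis by (intro that[of "x-e" "x+e"]) auto
qed

lemma AC_loc_dominated:
  assumes "AC_loc S f" "AC_loc S g"
    and "\<And>x y. x \<in> ivl S \<Longrightarrow> y \<in> ivl S \<Longrightarrow> norm (h y - h x) \<le> C * (norm (f y - f x) + norm (g y - g x))"
  shows "AC_loc S h"
  unfolding AC_loc_def
proof (intro ballI impI)
  fix c d assume cd: "c \<in> ivl S" "d \<in> ivl S" "c \<le> d"
  have "absolutely_continuous_on {c..d} f" "absolutely_continuous_on {c..d} g"
    using assms cd unfolding AC_loc_def by blast+
  then show "absolutely_continuous_on {c..d} h"
    by (rule absolutely_continuous_on_dominated)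
      (use assms(3) atLeastAtMost_subset_ivl[OF cd(1,2)] in blast)
qed

lemma AC_loc_cong:
  assumes "AC_loc S f" "\<And>x. x \<in> ivl S \<Longrightarrow> g x = f x"
  shows "AC_loc S g"
  by (rule AC_loc_dominated[OF assms(1) assms(1), where C = 1]) (simp add: assms(2))

lemma AC_loc_lincomb:
  assumes "AC_loc S f" "AC_loc S g"
  shows "AC_loc S (\<lambda>x. \<alpha> * f x + \<beta> * g x)"
proof (rule AC_loc_dominated[OF assms, where C = "norm \<alpha> + norm \<beta>"])
  fix x y
  have "\<alpha> * f y + \<beta> * g y - (\<alpha> * f x + \<beta> * g x) = \<alpha> * (f y - f x) + \<beta> * (g y - g x)"
    by (simp add: algebra_simps)
  then have "norm (\<alpha> * f y + \<beta> * g y - (\<alpha> * f x + \<beta> * g x)) \<le> norm \<alpha> * norm (f y - f x) + norm \<beta> * norm (g y - g x)"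
    by (metis norm_mult norm_triangle_ineq)
  also have "\<dots> \<le> (norm \<alpha> + norm \<beta>) * (norm (f y - f x) + norm (g y - g x))"
    by (simp add: algebra_simps)
  finally show "norm (\<alpha> * f y + \<beta> * g y - (\<alpha> * f x + \<beta> * g x))
    \<le> (norm \<alpha> + norm \<beta>) * (norm (f y - f x) + norm (g y - g x))" .
qed

lemma AC_loc_cnj:
  assumes "AC_loc S f"
  shows "AC_loc S (\<lambda>x. cnj (f x))"
  by (rule AC_loc_dominated[OF assms assms, where C = 1])
    (simp add: complex_cnj_diff[symmetric] del: complex_cnj_diff)

lemma AC_loc_mult:
  assumes "AC_loc S f" "AC_loc S g"
  shows "AC_loc S (\<lambda>x. f x * g x)"
  using assms absolutely_continuous_on_mult unfolding AC_loc_def by blast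

lemma AC_loc_imp_continuous_on:
  assumes "AC_loc S f"
  shows "continuous_on (ivl S) f"
proof (rule continuous_at_imp_continuous_on, rule ballI)
  fix x assume "x \<in> ivl S"
  then obtain c d where cd: "c \<in> ivl S" "d \<in> ivl S" "c < x" "x < d" by (rule ivl_compact_nbhd)
  then have "absolutely_continuous_on {c..d} f"
    using assms unfolding AC_loc_def by auto
  then have "continuous_on {c..d} f" by (rule absolutely_continuous_on_imp_continuous_on)
  then show "isCont f x"
    using cd by (intro continuous_on_interior[of "{c..d}"]) auto
qed

text \<open>The set where \<open>h\<close> is non-zero is open, and a negligible open set is
  empty.\<close>

lemma continuous_on_AE_zero_imp_zero:
  fixes h :: "real \<Rightarrow> complex"
  assumes "continuous_on U h" "open U" and ae: "AE x in lebesgue. x \<in> U \<longrightarrow> h x = 0" and x: "x \<in> U"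
  shows "h x = 0"
proof (rule ccontr)
  assume "h x \<noteq> 0"
  let ?V = "U \<inter> h -` (- {0})"
  have "open ?V" using assms(1,2) by (intro continuous_open_preimage) auto
  moreover have "x \<in> ?V" using x \<open>h x \<noteq> 0\<close> by simp
  moreover have "negligible ?V"
  proof -
    from ae obtain N where N: "{x \<in> space lebesgue. \<not> (x \<in> U \<longrightarrow> h x = 0)} \<subseteq> N" "N \<in> null_sets lebesgue"
      unfolding eventually_ae_filter by auto
    then have "?V \<subseteq> N" by auto
    with N(2) show ?thesis using negligible_subset negligible_iff_null_sets by blast
  qed
  ultimately show False using open_not_negligible by blast
qed

text \<open>Uniqueness of derivatives and \<open>coeff_p S x > 0\<close> give equality almost
  everywhere, and continuity gives it everywhere. Thus the choice made by \<open>pderiv_of\<close>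
  is determined on the interval.\<close>

lemma is_pderiv_unique:
  assumes co: "sl_coefficients S" and F: "is_pderiv S f F" and G: "is_pderiv S g G"
    and fg: "\<And>x. x \<in> ivl S \<Longrightarrow> f x = g x" and x: "x \<in> ivl S"
  shows "F x = G x"
proof -
  have "continuous_on (ivl S) (\<lambda>x. F x - G x)"
    using F G unfolding is_pderiv_def by (intro continuous_on_diff AC_loc_imp_continuous_on) simp_all
  moreover have "AE x in lebesgue. x \<in> ivl S \<longrightarrow> F x - G x = 0"
  proof -
    have "AE x in lebesgue. x \<in> ivl S \<longrightarrow> coeff_p S x > 0" using co unfolding sl_coefficients_def by simp
    moreover have "AE x in lebesgue. x \<in> ivl S \<longrightarrow>
        (f has_vector_derivative F x / of_real (coeff_p S x)) (at x)" using F unfolding is_pderiv_def by simp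
    moreover have "AE x in lebesgue. x \<in> ivl S \<longrightarrow>
        (g has_vector_derivative G x / of_real (coeff_p S x)) (at x)" using G unfolding is_pderiv_def by simp
    ultimately show ?thesis
    proof eventually_elim
      case (elim x)
      show ?case
      proof
        assume x: "x \<in> ivl S"
        with elim have "(g has_vector_derivative F x / of_real (coeff_p S x)) (at x)"
          using has_vector_derivative_transform_within_open[OF _ open_ivl x, of f _ g] fg by simp
        with elim x have "F x / of_real (coeff_p S x) = G x / of_real (coeff_p S x)"
          using vector_derivative_unique_at by blast
        with elim x show "F x - G x = 0" by simp
      qed
    qed
  qed
  ultimately have "F x - G x = 0" using continuous_on_AE_zero_imp_zero open_ivl x by blast
  then show ?thesis by simp
qed

text \<open>The first-order system equivalent to \<open>(\<ell> - z) f = 0\<close>, with \<open>F\<close> in the role of \<open>p f'\<close>.\<close>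

definition sl_pair :: "'z sl_expr_scheme \<Rightarrow> complex \<Rightarrow> (real \<Rightarrow> complex) \<Rightarrow> (real \<Rightarrow> complex) \<Rightarrow> bool" where
  "sl_pair S z f F \<longleftrightarrow> AC_loc S f \<and> AC_loc S F \<and>
     (AE x in lebesgue. x \<in> ivl S \<longrightarrow>
        (f has_vector_derivative F x / of_real (coeff_p S x)) (at x) \<and>
        (F has_vector_derivative - (z * of_real (coeff_w S x) + of_real (coeff_q S x)) * f x) (at x))"

lemma sl_pair_imp_is_pderiv: "sl_pair S z f F \<Longrightarrow> is_pderiv S f F"
  unfolding sl_pair_def is_pderiv_def by (auto elim: eventually_mono)

text \<open>Since w is positive almost everywhere, the equation can be solved for the derivative of
  p f'. The differentiability clause of \<open>sl_regular\<close> makes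
  \<open>vector_derivative\<close>, itself only a choice, a true derivative.\<close>

lemma solution_imp_sl_pair:
  assumes co: "sl_coefficients S" and sol: "solution S z f"
  shows "sl_pair S z f (pderiv_of S f)"
proof -
  let ?F = "pderiv_of S f"
  have "AE x in lebesgue. x \<in> ivl S \<longrightarrow> coeff_w S x > 0" using co unfolding sl_coefficients_def by simp
  moreover have "AE x in lebesgue. x \<in> ivl S \<longrightarrow> ell S f x = z * f x" using sol unfolding solution_def by simp
  moreover have "AE x in lebesgue. x \<in> ivl S \<longrightarrow> ?F differentiable (at x)"
    using sol unfolding solution_def sl_regular_def by simp
  moreover have "AE x in lebesgue. x \<in> ivl S \<longrightarrow>
        (f has_vector_derivative ?F x / of_real (coeff_p S x)) (at x)"
    using sol unfolding solution_def sl_regular_def is_pderiv_def by simp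
  ultimately have "AE x in lebesgue. x \<in> ivl S \<longrightarrow>
        (f has_vector_derivative ?F x / of_real (coeff_p S x)) (at x) \<and>
        (?F has_vector_derivative - (z * of_real (coeff_w S x) + of_real (coeff_q S x)) * f x) (at x)"
  proof eventually_elim
    case (elim x)
    show ?case
    proof (intro impI conjI)
      assume x: "x \<in> ivl S"
      show "(f has_vector_derivative ?F x / of_real (coeff_p S x)) (at x)" using elim x by simp
      have "z * f x * of_real (coeff_w S x) = - (vector_derivative ?F (at x) + of_real (coeff_q S x) * f x)"
        using elim x by (simp add: ell_def field_simps flip: \<open>x \<in> ivl S \<longrightarrow> ell S f x = z * f x\<close>[rule_format, OF x])
      then have "vector_derivative ?F (at x) = - (z * of_real (coeff_w S x) + of_real (coeff_q S x)) * f x"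
        by (simp add: algebra_simps eq_neg_iff_add_eq_0)
      then show "(?F has_vector_derivative - (z * of_real (coeff_w S x) + of_real (coeff_q S x)) * f x) (at x)"
        using elim x vector_derivative_works by metis
    qed
  qed
  then show ?thesis
    using sol unfolding sl_pair_def solution_def sl_regular_def is_pderiv_def by simp
qed

text \<open>The interval is open, so derivatives at its points do not see values outside. This
  permits passing to extensions by zero.\<close>

lemma sl_pair_cong:
  assumes P: "sl_pair S z f F" and "\<And>x. x \<in> ivl S \<Longrightarrow> g x = f x" "\<And>x. x \<in> ivl S \<Longrightarrow> G x = F x"
  shows "sl_pair S z g G"
  unfolding sl_pair_def
proof (intro conjI)
  show "AC_loc S g" "AC_loc S G" using P assms(2,3) AC_loc_cong unfolding sl_pair_def by blast+
  have "AE x in lebesgue. x \<in> ivl S \<longrightarrow>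
        (f has_vector_derivative F x / of_real (coeff_p S x)) (at x) \<and>
        (F has_vector_derivative - (z * of_real (coeff_w S x) + of_real (coeff_q S x)) * f x) (at x)"
    using P unfolding sl_pair_def by simp
  then show "AE x in lebesgue. x \<in> ivl S \<longrightarrow>
        (g has_vector_derivative G x / of_real (coeff_p S x)) (at x) \<and>
        (G has_vector_derivative - (z * of_real (coeff_w S x) + of_real (coeff_q S x)) * g x) (at x)"
  proof eventually_elim
    case (elim x)
    show ?case
      using elim assms(2,3) has_vector_derivative_transform_within_open[OF _ open_ivl, of f _ x S g]
       has_vector_derivative_transform_within_open[OF _ open_ivl, of F _ x S G] by (simp)
  qed
qed

text \<open>Identifies an \<open>F\<close> found by algebra, such as a linear combination or a
  conjugate, with the chosen representative that enters \<open>bracket\<close>.\<close>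

lemma sl_pair_pderiv_of:
  assumes co: "sl_coefficients S" and P: "sl_pair S z f F" and x: "x \<in> ivl S"
  shows "pderiv_of S f x = F x"
proof -
  have "is_pderiv S f (pderiv_of S f)"
    unfolding pderiv_of_def by (rule someI[where P = "is_pderiv S f", OF sl_pair_imp_is_pderiv[OF P]])
  then show ?thesis using is_pderiv_unique[OF co _ sl_pair_imp_is_pderiv[OF P]] x by blast
qed

lemma sl_pair_imp_solution:
  assumes co: "sl_coefficients S" and P: "sl_pair S z f F"
  shows "solution S z f"
proof -
  let ?F = "pderiv_of S f"
  have P': "sl_pair S z f ?F"
    using sl_pair_cong[OF P] sl_pair_pderiv_of[OF co P] by simp
  then have ae: "AE x in lebesgue. x \<in> ivl S \<longrightarrow>
        (f has_vector_derivative ?F x / of_real (coeff_p S x)) (at x) \<and>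
        (?F has_vector_derivative - (z * of_real (coeff_w S x) + of_real (coeff_q S x)) * f x) (at x)"
    unfolding sl_pair_def by simp
  moreover have "AE x in lebesgue. x \<in> ivl S \<longrightarrow> coeff_w S x > 0" using co unfolding sl_coefficients_def by simp
  ultimately have "AE x in lebesgue. x \<in> ivl S \<longrightarrow> ell S f x = z * f x"
  proof eventually_elim
    case (elim x)
    show ?case
    proof
      assume x: "x \<in> ivl S"
      with elim have "vector_derivative ?F (at x) = - (z * of_real (coeff_w S x) + of_real (coeff_q S x)) * f x"
        by (simp add: vector_derivative_at)
      with elim x show "ell S f x = z * f x" by (simp add: ell_def) (simp add: field_simps)
    qed
  qed
  moreover have "AE x in lebesgue. x \<in> ivl S \<longrightarrow> ?F differentiable (at x)"
    using ae by eventually_elim (auto simp: differentiableI_vector)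
  ultimately show ?thesis
    using P' sl_pair_imp_is_pderiv[OF P'] unfolding solution_def sl_regular_def sl_pair_def by simp
qed

lemma sl_pair_lincomb:
  assumes f: "sl_pair S z f F" and g: "sl_pair S z g G"
  shows "sl_pair S z (\<lambda>x. \<alpha> * f x + \<beta> * g x) (\<lambda>x. \<alpha> * F x + \<beta> * G x)"
  unfolding sl_pair_def
proof (intro conjI)
  show "AC_loc S (\<lambda>x. \<alpha> * f x + \<beta> * g x)" "AC_loc S (\<lambda>x. \<alpha> * F x + \<beta> * G x)"
    using f g AC_loc_lincomb unfolding sl_pair_def by blast+
  have "AE x in lebesgue. x \<in> ivl S \<longrightarrow>
        (f has_vector_derivative F x / of_real (coeff_p S x)) (at x) \<and>
        (F has_vector_derivative - (z * of_real (coeff_w S x) + of_real (coeff_q S x)) * f x) (at x)"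
     "AE x in lebesgue. x \<in> ivl S \<longrightarrow>
        (g has_vector_derivative G x / of_real (coeff_p S x)) (at x) \<and>
        (G has_vector_derivative - (z * of_real (coeff_w S x) + of_real (coeff_q S x)) * g x) (at x)"
    using f g unfolding sl_pair_def by simp_all
  then show "AE x in lebesgue. x \<in> ivl S \<longrightarrow>
        ((\<lambda>x. \<alpha> * f x + \<beta> * g x) has_vector_derivative (\<alpha> * F x + \<beta> * G x) / of_real (coeff_p S x)) (at x) \<and>
        ((\<lambda>x. \<alpha> * F x + \<beta> * G x) has_vector_derivative - (z * of_real (coeff_w S x) + of_real (coeff_q S x)) * (\<alpha> * f x + \<beta> * g x)) (at x)"
  proof eventually_elim
    case (elim x)
    have lin: "((\<lambda>x. \<alpha> * a x + \<beta> * b x) has_vector_derivative \<alpha> * a' + \<beta> * b') (at x)"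
      if "(a has_vector_derivative a') (at x)" "(b has_vector_derivative b') (at x)" for a b a' b'
      using that by (intro has_vector_derivative_add has_vector_derivative_mult_right)
    show ?case
    proof (intro impI conjI)
      assume x: "x \<in> ivl S"
      show "((\<lambda>x. \<alpha> * f x + \<beta> * g x) has_vector_derivative (\<alpha> * F x + \<beta> * G x) / of_real (coeff_p S x)) (at x)"
        using lin[of f "F x / of_real (coeff_p S x)" g "G x / of_real (coeff_p S x)"] elim x by (simp add: add_divide_distrib)
      have "\<alpha> * (- (z * of_real (coeff_w S x) + of_real (coeff_q S x)) * f x) + \<beta> * (- (z * of_real (coeff_w S x) + of_real (coeff_q S x)) * g x)
        = - (z * of_real (coeff_w S x) + of_real (coeff_q S x)) * (\<alpha> * f x + \<beta> * g x)" by (simp add: algebra_simps)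
      then show "((\<lambda>x. \<alpha> * F x + \<beta> * G x) has_vector_derivative - (z * of_real (coeff_w S x) + of_real (coeff_q S x)) * (\<alpha> * f x + \<beta> * g x)) (at x)"
        using lin[of F "- (z * of_real (coeff_w S x) + of_real (coeff_q S x)) * f x" G "- (z * of_real (coeff_w S x) + of_real (coeff_q S x)) * g x"] elim x by simp
    qed
  qed
qed

text \<open>The coefficients p, q and w are real, so conjugation affects only the spectral
  parameter.\<close>

lemma sl_pair_cnj:
  assumes f: "sl_pair S z f F"
  shows "sl_pair S (cnj z) (\<lambda>x. cnj (f x)) (\<lambda>x. cnj (F x))"
  unfolding sl_pair_def
proof (intro conjI)
  show "AC_loc S (\<lambda>x. cnj (f x))" "AC_loc S (\<lambda>x. cnj (F x))"
    using f AC_loc_cnj unfolding sl_pair_def by blast+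
  have "AE x in lebesgue. x \<in> ivl S \<longrightarrow>
        (f has_vector_derivative F x / of_real (coeff_p S x)) (at x) \<and>
        (F has_vector_derivative - (z * of_real (coeff_w S x) + of_real (coeff_q S x)) * f x) (at x)"
    using f unfolding sl_pair_def by simp
  then show "AE x in lebesgue. x \<in> ivl S \<longrightarrow>
        ((\<lambda>x. cnj (f x)) has_vector_derivative cnj (F x) / of_real (coeff_p S x)) (at x) \<and>
        ((\<lambda>x. cnj (F x)) has_vector_derivative - (cnj z * of_real (coeff_w S x) + of_real (coeff_q S x)) * cnj (f x)) (at x)"
  proof eventually_elim
    case (elim x)
    have c: "((\<lambda>x. cnj (a x)) has_vector_derivative cnj a') (at x)" if "(a has_vector_derivative a') (at x)" for a a'
      using that by (rule has_vector_derivative_cnj)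
    show ?case using elim c[of f "F x / of_real (coeff_p S x)"]
        c[of F "- (z * of_real (coeff_w S x) + of_real (coeff_q S x)) * f x"] by simp
  qed
qed

text \<open>Bilinear, unlike \<open>bracket\<close>: for two solutions with the same z it is
  constant even if z is not real.\<close>

definition wronskian :: "(real \<Rightarrow> complex) \<Rightarrow> (real \<Rightarrow> complex) \<Rightarrow> (real \<Rightarrow> complex) \<Rightarrow> (real \<Rightarrow> complex) \<Rightarrow> real \<Rightarrow> complex" where
  "wronskian f F g G x = f x * G x - F x * g x"

text \<open>Lagrange's identity, integrated: in the derivative the terms with 1/p and with q cancel.
  Equal parameters yield constancy, different ones an explicit derivative from which limits at the
  endpoints are derived.\<close>

lemma wronskian_has_integral:
  assumes f: "sl_pair S z f F" and g: "sl_pair S \<zeta> g G" and cd: "c \<in> ivl S" "d \<in> ivl S" "c \<le> d"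
  shows "((\<lambda>x. (z - \<zeta>) * (f x * g x * of_real (coeff_w S x))) has_integral wronskian f F g G d - wronskian f F g G c) {c..d}"
proof -
  have "AC_loc S (\<lambda>x. 1 * (f x * G x) + (-1) * (F x * g x))"
    using f g by (intro AC_loc_lincomb AC_loc_mult) (auto simp: sl_pair_def)
  then have "AC_loc S (wronskian f F g G)"
    by (rule AC_loc_cong) (simp add: wronskian_def)
  then have ac: "absolutely_continuous_on {c..d} (wronskian f F g G)"
    using cd unfolding AC_loc_def by blast
  have "AE x in lebesgue. x \<in> ivl S \<longrightarrow>
        (f has_vector_derivative F x / of_real (coeff_p S x)) (at x) \<and>
        (F has_vector_derivative - (z * of_real (coeff_w S x) + of_real (coeff_q S x)) * f x) (at x)"
     "AE x in lebesgue. x \<in> ivl S \<longrightarrow>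
        (g has_vector_derivative G x / of_real (coeff_p S x)) (at x) \<and>
        (G has_vector_derivative - (\<zeta> * of_real (coeff_w S x) + of_real (coeff_q S x)) * g x) (at x)"
    using f g unfolding sl_pair_def by simp_all
  then have "AE x in lebesgue. x \<in> ivl S \<longrightarrow>
     (wronskian f F g G has_vector_derivative (z - \<zeta>) * (f x * g x * of_real (coeff_w S x))) (at x)"
  proof eventually_elim
    case (elim x)
    show ?case
    proof
      assume x: "x \<in> ivl S"
      let ?q = "\<lambda>z. - (z * of_real (coeff_w S x) + of_real (coeff_q S x))"
      have "((\<lambda>x. f x * G x - F x * g x) has_vector_derivative
        (f x * (?q \<zeta> * g x) + (F x / of_real (coeff_p S x)) * G x) - (F x * (G x / of_real (coeff_p S x)) + (?q z * f x) * g x)) (at x)"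
        using elim x by (intro has_vector_derivative_diff has_vector_derivative_mult) auto
      moreover have "(f x * (?q \<zeta> * g x) + (F x / of_real (coeff_p S x)) * G x) - (F x * (G x / of_real (coeff_p S x)) + (?q z * f x) * g x)
        = (z - \<zeta>) * (f x * g x * of_real (coeff_w S x))"
        by (simp add: algebra_simps)
      ultimately show "(wronskian f F g G has_vector_derivative (z - \<zeta>) * (f x * g x * of_real (coeff_w S x))) (at x)"
        unfolding wronskian_def by simp
    qed
  qed
  then obtain N where N: "{x \<in> space lebesgue. \<not> (x \<in> ivl S \<longrightarrow>
     (wronskian f F g G has_vector_derivative (z - \<zeta>) * (f x * g x * of_real (coeff_w S x))) (at x))} \<subseteq> N"
    "N \<in> null_sets lebesgue"
    unfolding eventually_ae_filter by auto
  show ?thesis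
  proof (rule fundamental_theorem_of_calculus_absolutely_continuous[OF cd(3) ac])
    show "negligible N" using N(2) negligible_iff_null_sets by blast
    fix x assume "x \<in> {c..d} - N"
    then have "x \<in> ivl S" "x \<notin> N" using atLeastAtMost_subset_ivl[OF cd(1,2)] by auto
    then show "(wronskian f F g G has_vector_derivative (z - \<zeta>) * (f x * g x * of_real (coeff_w S x))) (at x within {c..d})"
      using contra_subsetD[OF N(1)] by (simp add: has_vector_derivative_at_within)
  qed
qed

lemma wronskian_const:
  assumes f: "sl_pair S z f F" and g: "sl_pair S z g G" and cd: "c \<in> ivl S" "d \<in> ivl S"
  shows "wronskian f F g G c = wronskian f F g G d"
proof -
  have *: "wronskian f F g G d = wronskian f F g G c" if "c \<in> ivl S" "d \<in> ivl S" "c \<le> d" for c d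
  proof -
    have "((\<lambda>x. 0) has_integral wronskian f F g G d - wronskian f F g G c) {c..d}"
      using wronskian_has_integral[OF f g that] by simp
    moreover have "((\<lambda>x. 0::complex) has_integral 0) {c..d}" by simp
    ultimately show ?thesis using has_integral_unique by fastforce
  qed
  show ?thesis using *[of c d] *[of d c] cd by (cases "c \<le> d") auto
qed

section \<open>Limits at the endpoints\<close>

text \<open>\<open>W x\<close> is \<open>W y0\<close> minus the integral of \<open>h\<close> over
  \<open>{x..y0}\<close>, which converges by dominated convergence as x approaches \<open>a\<close>.
  The limit is taken in \<open>ereal\<close> because \<open>a\<close> may be -\<infinity>.\<close>

lemma tendsto_at_right_of_integrable_derivative:
  fixes W h :: "real \<Rightarrow> complex" and a :: ereal
  assumes h: "set_integrable lebesgue (einterval a (ereal c)) h" and ac: "a < ereal c"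
    and W: "\<And>x y. a < ereal x \<Longrightarrow> x \<le> y \<Longrightarrow> y < c \<Longrightarrow> (h has_integral W y - W x) {x..y}"
  shows "\<exists>L. ((W \<circ> real_of_ereal) \<longlongrightarrow> L) (at_right a)"
proof -
  \<comment> \<open>The assumption on \<open>W\<close> stops short of \<open>c\<close>, so the fixed
    base point has to lie strictly below it.\<close>
  obtain y0 where y0: "a < ereal y0" "y0 < c" using ereal_dense2[OF ac] by auto
  define A where "A = einterval a (ereal y0) \<union> {y0}"
  have A: "A \<in> sets lebesgue" "A \<subseteq> einterval a (ereal c)"
    using y0 by (auto simp: A_def einterval_def intro: less_trans)
  have hA: "set_integrable lebesgue A h" by (rule set_integrable_subset[OF h A])
  have "((W \<circ> real_of_ereal) \<longlongrightarrow> W y0 - (LINT x:A|lebesgue. h x)) (at_right a)"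
  proof (rule tendsto_at_right_sequentially[OF y0(1)])
    fix X :: "nat \<Rightarrow> ereal"
    assume X: "\<And>n. a < X n" "\<And>n. X n < ereal y0" "X \<longlonglongrightarrow> a"
    define s where "s n = real_of_ereal (X n)" for n
    have es: "ereal (s n) = X n" for n
      unfolding s_def using X(1)[of n] X(2)[of n] by (intro ereal_real') auto
    have s: "a < ereal (s n)" "s n < y0" for n
      using X(1,2)[of n] by (simp_all add: es[symmetric])
    have sub: "{s n..y0} \<subseteq> A" for n
    proof
      fix x assume "x \<in> {s n..y0}"
      then have "a < ereal x" "x \<le> y0" using less_le_trans[OF s(1), of n "ereal x"] by auto
      then show "x \<in> A" by (auto simp: A_def einterval_def)
    qed
    have hs: "set_integrable lebesgue {s n..y0} h" for n
      by (rule set_integrable_subset[OF hA _ sub]) simp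
    have Wn: "(W \<circ> real_of_ereal) (X n) = W y0 - (LINT x:{s n..y0}|lebesgue. h x)" for n
      using set_lebesgue_integral_eq_integral(2)[OF hs[of n]] integral_unique[OF W[OF s(1)[of n], of y0]] s(2)[of n] y0(2)
      by (simp add: s_def)
    have "(\<lambda>n. LINT x:{s n..y0}|lebesgue. h x) \<longlonglongrightarrow> (LINT x:A|lebesgue. h x)"
      unfolding set_lebesgue_integral_def
    proof (rule integral_dominated_convergence[where w = "\<lambda>x. norm (indicator A x *\<^sub>R h x)"])
      show "integrable lebesgue (\<lambda>x. norm (indicator A x *\<^sub>R h x))"
        using hA unfolding set_integrable_def by (rule integrable_norm)
      show "(\<lambda>x. indicator A x *\<^sub>R h x) \<in> borel_measurable lebesgue"
        using hA unfolding set_integrable_def by (rule borel_measurable_integrable)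
      show "(\<lambda>x. indicator {s n..y0} x *\<^sub>R h x) \<in> borel_measurable lebesgue" for n
        using hs unfolding set_integrable_def by (rule borel_measurable_integrable)
      show "AE x in lebesgue. norm (indicator {s n..y0} x *\<^sub>R h x) \<le> norm (indicator A x *\<^sub>R h x)" for n
        using sub[of n] by (intro AE_I2) (auto simp: indicator_def)
      show "AE x in lebesgue. (\<lambda>n. indicator {s n..y0} x *\<^sub>R h x) \<longlonglongrightarrow> indicator A x *\<^sub>R h x"
      proof (intro AE_I2)
        fix x
        show "(\<lambda>n. indicator {s n..y0} x *\<^sub>R h x) \<longlonglongrightarrow> indicator A x *\<^sub>R h x"
        proof (cases "x \<in> A")
          case True
          then have x: "a < ereal x" "x \<le> y0" using y0 by (auto simp: A_def einterval_def)
          \<comment> \<open>As \<open>X\<close> tends to \<open>a\<close>, each fixed point of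
            \<open>A\<close> is eventually covered by the intervals
            \<open>{s n..y0}\<close>.\<close>
          have "eventually (\<lambda>n. X n < ereal x) sequentially"
            using X(3) x(1) by (rule order_tendstoD(2))
          then have "eventually (\<lambda>n. indicator {s n..y0} x *\<^sub>R h x = indicator A x *\<^sub>R h x) sequentially"
            by eventually_elim (use True x in \<open>simp add: es[symmetric]\<close>)
          then show ?thesis by (rule tendsto_eventually)
        next
          case False
          then have "x \<notin> {s n..y0}" for n using sub by blast
          with False show ?thesis by simp
        qed
      qed
    qed
    then show "(\<lambda>n. (W \<circ> real_of_ereal) (X n)) \<longlonglongrightarrow> W y0 - (LINT x:A|lebesgue. h x)"
      unfolding Wn by (intro tendsto_diff tendsto_const)
  qed
  then show ?thesis by blast
qed

text \<open>Mirror image at the right end, where the integral over \<open>{y0..x}\<close> is added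
  to \<open>W y0\<close>.\<close>

lemma tendsto_at_left_of_integrable_derivative:
  fixes W h :: "real \<Rightarrow> complex" and b :: ereal
  assumes h: "set_integrable lebesgue (einterval (ereal c) b) h" and cb: "ereal c < b"
    and W: "\<And>x y. c < x \<Longrightarrow> x \<le> y \<Longrightarrow> ereal y < b \<Longrightarrow> (h has_integral W y - W x) {x..y}"
  shows "\<exists>L. ((W \<circ> real_of_ereal) \<longlongrightarrow> L) (at_left b)"
proof -
  obtain y0 where y0: "ereal y0 < b" "c < y0" using ereal_dense2[OF cb] by auto
  define A where "A = insert y0 (einterval (ereal y0) b)"
  have A: "A \<in> sets lebesgue" "A \<subseteq> einterval (ereal c) b"
    using y0 by (auto simp: A_def einterval_def intro: less_trans)
  have hA: "set_integrable lebesgue A h" by (rule set_integrable_subset[OF h A])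
  have "((W \<circ> real_of_ereal) \<longlongrightarrow> W y0 + (LINT x:A|lebesgue. h x)) (at_left b)"
  proof (rule tendsto_at_left_sequentially[OF y0(1)])
    fix X :: "nat \<Rightarrow> ereal"
    assume X: "\<And>n. X n < b" "\<And>n. ereal y0 < X n" "X \<longlonglongrightarrow> b"
    define s where "s n = real_of_ereal (X n)" for n
    have es: "ereal (s n) = X n" for n
      unfolding s_def using X(1)[of n] X(2)[of n] by (intro ereal_real') auto
    have s: "ereal (s n) < b" "y0 < s n" for n
      using X(1,2)[of n] by (simp_all add: es[symmetric])
    have sub: "{y0..s n} \<subseteq> A" for n
    proof
      fix x assume "x \<in> {y0..s n}"
      then have "ereal x < b" "y0 \<le> x" using le_less_trans[OF _ s(1), of "ereal x" n] by auto
      then show "x \<in> A" by (auto simp: A_def einterval_def)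
    qed
    have hs: "set_integrable lebesgue {y0..s n} h" for n
      by (rule set_integrable_subset[OF hA _ sub]) simp
    have Wn: "(W \<circ> real_of_ereal) (X n) = W y0 + (LINT x:{y0..s n}|lebesgue. h x)" for n
      using set_lebesgue_integral_eq_integral(2)[OF hs[of n]] integral_unique[OF W[OF y0(2) _ s(1)[of n]]] s(2)[of n]
      by (simp add: s_def)
    have "(\<lambda>n. LINT x:{y0..s n}|lebesgue. h x) \<longlonglongrightarrow> (LINT x:A|lebesgue. h x)"
      unfolding set_lebesgue_integral_def
    proof (rule integral_dominated_convergence[where w = "\<lambda>x. norm (indicator A x *\<^sub>R h x)"])
      show "integrable lebesgue (\<lambda>x. norm (indicator A x *\<^sub>R h x))"
        using hA unfolding set_integrable_def by (rule integrable_norm)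
      show "(\<lambda>x. indicator A x *\<^sub>R h x) \<in> borel_measurable lebesgue"
        using hA unfolding set_integrable_def by (rule borel_measurable_integrable)
      show "(\<lambda>x. indicator {y0..s n} x *\<^sub>R h x) \<in> borel_measurable lebesgue" for n
        using hs unfolding set_integrable_def by (rule borel_measurable_integrable)
      show "AE x in lebesgue. norm (indicator {y0..s n} x *\<^sub>R h x) \<le> norm (indicator A x *\<^sub>R h x)" for n
        using sub[of n] by (intro AE_I2) (auto simp: indicator_def)
      show "AE x in lebesgue. (\<lambda>n. indicator {y0..s n} x *\<^sub>R h x) \<longlonglongrightarrow> indicator A x *\<^sub>R h x"
      proof (intro AE_I2)
        fix x
        show "(\<lambda>n. indicator {y0..s n} x *\<^sub>R h x) \<longlonglongrightarrow> indicator A x *\<^sub>R h x"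
        proof (cases "x \<in> A")
          case True
          then have x: "ereal x < b" "y0 \<le> x" using y0 by (auto simp: A_def einterval_def)
          have "eventually (\<lambda>n. ereal x < X n) sequentially"
            using X(3) x(1) by (rule order_tendstoD(1))
          then have "eventually (\<lambda>n. indicator {y0..s n} x *\<^sub>R h x = indicator A x *\<^sub>R h x) sequentially"
            by eventually_elim (use True x in \<open>simp add: es[symmetric]\<close>)
          then show ?thesis by (rule tendsto_eventually)
        next
          case False
          then have "x \<notin> {y0..s n}" for n using sub by blast
          with False show ?thesis by simp
        qed
      qed
    qed
    then show "(\<lambda>n. (W \<circ> real_of_ereal) (X n)) \<longlonglongrightarrow> W y0 + (LINT x:A|lebesgue. h x)"
      unfolding Wn by (intro tendsto_add tendsto_const)
  qed
  then show ?thesis by blast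
qed

section \<open>Integrability of products and squares of solutions with respect to the weight\<close>

text \<open>Local integrability gives measurability on compact subintervals only. An increasing
  exhaustion by such intervals has truncations that are eventually constant at each point, so
  measurability passes to the limit.\<close>

lemma set_borel_measurable_L1_loc:
  assumes ab: "lend S < rend S" and h: "L1_loc S h"
  shows "set_borel_measurable lebesgue (ivl S) h"
proof -
  obtain u l :: "nat \<Rightarrow> real" where
    "einterval (lend S) (rend S) = (\<Union>i. {l i .. u i})" and ul': "incseq u" "decseq l" "\<And>i. l i < u i"
    "\<And>i. lend S < l i" "\<And>i. u i < rend S" "l \<longlonglongrightarrow> lend S" "u \<longlonglongrightarrow> rend S"
    by (blast intro: einterval_Icc_approximation[OF ab])
  then have ul: "ivl S = (\<Union>i. {l i .. u i})" "incseq u" "decseq l" "\<And>i. l i < u i"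
    by (simp_all add: ivl_def)
  have "set_integrable lebesgue {l i..u i} h" for i
  proof -
    have "{l i..u i} \<subseteq> ivl S" using ul(1) by blast
    then have "l i \<in> ivl S" "u i \<in> ivl S" using ul(4)[of i] by (simp_all add: subset_iff less_imp_le)
    then show ?thesis using h ul(4)[of i] unfolding L1_loc_def by (simp add: less_imp_le)
  qed
  then have "(\<lambda>x. indicator {l i..u i} x *\<^sub>R h x) \<in> borel_measurable lebesgue" for i
    unfolding set_integrable_def by (rule borel_measurable_integrable)
  then show ?thesis
    unfolding set_borel_measurable_def
  proof (rule borel_measurable_LIMSEQ_real[rotated])
    fix x
    show "(\<lambda>i. indicator {l i..u i} x *\<^sub>R h x) \<longlonglongrightarrow> indicator (ivl S) x *\<^sub>R h x"
    proof (cases "x \<in> ivl S")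
      case True
      then obtain N where N: "x \<in> {l N..u N}" using ul(1) by blast
      have "x \<in> {l i..u i}" if "i \<ge> N" for i
        using N decseqD[OF ul(3) that] incseqD[OF ul(2) that] by auto
      then have "eventually (\<lambda>i. indicator {l i..u i} x *\<^sub>R h x = indicator (ivl S) x *\<^sub>R h x) sequentially"
        using True by (intro eventually_sequentiallyI[of N]) simp
      then show ?thesis by (rule tendsto_eventually)
    next
      case False
      then have "x \<notin> {l i..u i}" for i using ul(1) by blast
      with False show ?thesis by simp
    qed
  qed
qed

lemma set_borel_measurable_continuous_ivl:
  fixes f :: "real \<Rightarrow> complex"
  assumes "continuous_on (ivl S) f"
  shows "set_borel_measurable lebesgue (ivl S) f"
  unfolding set_borel_measurable_def
  using borel_measurable_continuous_on_indicator[OF borel_open[OF open_ivl] assms]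
  by (simp add: measurable_completion)

text \<open>Pointwise |f g| is at most |f|^2 + |g|^2, and w is positive almost everywhere.\<close>

lemma set_integrable_weighted_product:
  fixes f g :: "real \<Rightarrow> complex"
  assumes co: "sl_coefficients S" and A: "A \<subseteq> ivl S" "A \<in> sets lebesgue"
    and f: "continuous_on (ivl S) f" "set_integrable lebesgue A (\<lambda>x. (norm (f x))\<^sup>2 * coeff_w S x)"
    and g: "continuous_on (ivl S) g" "set_integrable lebesgue A (\<lambda>x. (norm (g x))\<^sup>2 * coeff_w S x)"
  shows "set_integrable lebesgue A (\<lambda>x. f x * g x * of_real (coeff_w S x))"
proof (rule set_integrable_bound[OF set_integral_add(1)[OF f(2) g(2)]])
  have "(\<lambda>x. indicator (ivl S) x *\<^sub>R f x) \<in> borel_measurable lebesgue"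
    "(\<lambda>x. indicator (ivl S) x *\<^sub>R g x) \<in> borel_measurable lebesgue"
    "(\<lambda>x. indicator (ivl S) x *\<^sub>R coeff_w S x) \<in> borel_measurable lebesgue"
    using set_borel_measurable_continuous_ivl[OF f(1)] set_borel_measurable_continuous_ivl[OF g(1)]
     set_borel_measurable_L1_loc[of S "coeff_w S"] co
    unfolding set_borel_measurable_def sl_coefficients_def by blast+
  \<comment> \<open>The factors are known to be measurable only after truncation to
    \<open>ivl S\<close>; on \<open>A\<close>, a subset, the inner truncations disappear.\<close>
  then have "(\<lambda>x. indicator A x *\<^sub>R ((indicator (ivl S) x *\<^sub>R f x) * (indicator (ivl S) x *\<^sub>R g x) * of_real (indicator (ivl S) x *\<^sub>R coeff_w S x)))
     \<in> borel_measurable lebesgue" using A(2) by measurable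
  also have "(\<lambda>x. indicator A x *\<^sub>R ((indicator (ivl S) x *\<^sub>R f x) * (indicator (ivl S) x *\<^sub>R g x) * of_real (indicator (ivl S) x *\<^sub>R coeff_w S x)))
    = (\<lambda>x. indicator A x *\<^sub>R (f x * g x * of_real (coeff_w S x)))"
    using A(1) by (auto simp: fun_eq_iff indicator_def)
  finally show "set_borel_measurable lebesgue A (\<lambda>x. f x * g x * of_real (coeff_w S x))"
    unfolding set_borel_measurable_def .
  have "AE x in lebesgue. x \<in> ivl S \<longrightarrow> coeff_w S x > 0" using co unfolding sl_coefficients_def by simp
  then show "AE x in lebesgue. x \<in> A \<longrightarrow> norm (f x * g x * of_real (coeff_w S x))
     \<le> norm ((norm (f x))\<^sup>2 * coeff_w S x + (norm (g x))\<^sup>2 * coeff_w S x)"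
  proof eventually_elim
    case (elim x)
    show ?case
    proof
      assume "x \<in> A"
      then have w: "coeff_w S x > 0" using elim A by blast
      have "0 \<le> (norm (f x) - norm (g x))\<^sup>2" by simp
      then have "norm (f x) * norm (g x) * 2 \<le> (norm (f x))\<^sup>2 + (norm (g x))\<^sup>2"
        by (simp add: power2_diff algebra_simps)
      moreover have "0 \<le> norm (f x) * norm (g x)" by simp
      ultimately have "norm (f x) * norm (g x) \<le> (norm (f x))\<^sup>2 + (norm (g x))\<^sup>2" by linarith
      then have "norm (f x) * norm (g x) * coeff_w S x \<le> ((norm (f x))\<^sup>2 + (norm (g x))\<^sup>2) * coeff_w S x"
        using w by (intro mult_right_mono) auto
      then show "norm (f x * g x * of_real (coeff_w S x))
         \<le> norm ((norm (f x))\<^sup>2 * coeff_w S x + (norm (g x))\<^sup>2 * coeff_w S x)"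
        using w by (simp add: norm_mult distrib_right)
    qed
  qed
qed

lemma mem_ivl_iff: "x \<in> ivl S \<longleftrightarrow> lend S < ereal x \<and> ereal x < rend S"
  by (simp add: ivl_def einterval_def)

text \<open>The limit-circle condition speaks about every spectral parameter, so \<open>f\<close>
  and \<open>g\<close> are both square integrable near the endpoint although z and \<zeta> may
  differ. Their weighted product is then integrable there, and so is the derivative of the
  Wronskian.\<close>

lemma wronskian_tendsto_a:
  assumes co: "sl_coefficients S" and lc: "limit_circle_a S"
    and f: "sl_pair S z f F" and g: "sl_pair S \<zeta> g G"
  shows "\<exists>L. ((wronskian f F g G \<circ> real_of_ereal) \<longlongrightarrow> L) (at_right (lend S))"
proof -
  obtain c1 c2 where c: "c1 \<in> ivl S" "c2 \<in> ivl S"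
    "set_integrable lebesgue (einterval (lend S) (ereal c1)) (\<lambda>x. (norm (f x))\<^sup>2 * coeff_w S x)"
    "set_integrable lebesgue (einterval (lend S) (ereal c2)) (\<lambda>x. (norm (g x))\<^sup>2 * coeff_w S x)"
    using lc sl_pair_imp_solution[OF co f] sl_pair_imp_solution[OF co g]
    unfolding limit_circle_a_def integrable_near_a_def by blast
  define c where "c = min c1 c2"
  have cS: "c \<in> ivl S" using c by (simp add: c_def min_def)
  let ?A = "einterval (lend S) (ereal c)"
  have sub: "?A \<subseteq> einterval (lend S) (ereal c1)" "?A \<subseteq> einterval (lend S) (ereal c2)"
    by (auto simp: einterval_def c_def)
  have A: "?A \<subseteq> ivl S" "?A \<in> sets lebesgue"
    using cS by (auto simp: einterval_def ivl_def intro: less_trans[of _ "ereal c"])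
  have "set_integrable lebesgue ?A (\<lambda>x. f x * g x * of_real (coeff_w S x))"
    using set_integrable_subset[OF c(3) A(2) sub(1)] set_integrable_subset[OF c(4) A(2) sub(2)] f g
    by (intro set_integrable_weighted_product[OF co A]) (auto simp: sl_pair_def AC_loc_imp_continuous_on)
  then have "set_integrable lebesgue ?A (\<lambda>x. (z - \<zeta>) * (f x * g x * of_real (coeff_w S x)))"
    by (intro set_integrable_mult_right)
  then show ?thesis
  proof (rule tendsto_at_right_of_integrable_derivative)
    show "lend S < ereal c" using cS by (simp add: mem_ivl_iff)
    fix x y assume xy: "lend S < ereal x" "x \<le> y" "y < c"
    have "ereal y < rend S" using cS xy(3) by (auto simp: mem_ivl_iff intro: less_trans[of _ "ereal c"])
    then have "x \<in> ivl S" "y \<in> ivl S"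
      using xy le_less_trans[of "ereal x" "ereal y" "rend S"] less_le_trans[of "lend S" "ereal x" "ereal y"] by (auto simp: mem_ivl_iff)
    then show "((\<lambda>x. (z - \<zeta>) * (f x * g x * of_real (coeff_w S x))) has_integral wronskian f F g G y - wronskian f F g G x) {x..y}"
      using wronskian_has_integral[OF f g] xy(2) by blast
  qed
qed

lemma wronskian_tendsto_b:
  assumes co: "sl_coefficients S" and lc: "limit_circle_b S"
    and f: "sl_pair S z f F" and g: "sl_pair S \<zeta> g G"
  shows "\<exists>L. ((wronskian f F g G \<circ> real_of_ereal) \<longlongrightarrow> L) (at_left (rend S))"
proof -
  obtain c1 c2 where c: "c1 \<in> ivl S" "c2 \<in> ivl S"
    "set_integrable lebesgue (einterval (ereal c1) (rend S)) (\<lambda>x. (norm (f x))\<^sup>2 * coeff_w S x)"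
    "set_integrable lebesgue (einterval (ereal c2) (rend S)) (\<lambda>x. (norm (g x))\<^sup>2 * coeff_w S x)"
    using lc sl_pair_imp_solution[OF co f] sl_pair_imp_solution[OF co g]
    unfolding limit_circle_b_def integrable_near_b_def by blast
  define c where "c = max c1 c2"
  have cS: "c \<in> ivl S" using c by (simp add: c_def max_def)
  let ?A = "einterval (ereal c) (rend S)"
  have sub: "?A \<subseteq> einterval (ereal c1) (rend S)" "?A \<subseteq> einterval (ereal c2) (rend S)"
    by (auto simp: einterval_def c_def)
  have A: "?A \<subseteq> ivl S" "?A \<in> sets lebesgue"
    using cS by (auto simp: einterval_def ivl_def intro: less_trans[of _ "ereal c"])
  have "set_integrable lebesgue ?A (\<lambda>x. f x * g x * of_real (coeff_w S x))"
    using set_integrable_subset[OF c(3) A(2) sub(1)] set_integrable_subset[OF c(4) A(2) sub(2)] f g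
    by (intro set_integrable_weighted_product[OF co A]) (auto simp: sl_pair_def AC_loc_imp_continuous_on)
  then have "set_integrable lebesgue ?A (\<lambda>x. (z - \<zeta>) * (f x * g x * of_real (coeff_w S x)))"
    by (intro set_integrable_mult_right)
  then show ?thesis
  proof (rule tendsto_at_left_of_integrable_derivative)
    show "ereal c < rend S" using cS by (simp add: mem_ivl_iff)
    fix x y assume xy: "c < x" "x \<le> y" "ereal y < rend S"
    have "lend S < ereal x" using cS xy(1) by (auto simp: mem_ivl_iff intro: less_trans[of _ "ereal c"])
    then have "x \<in> ivl S" "y \<in> ivl S"
      using xy le_less_trans[of "ereal x" "ereal y" "rend S"] less_le_trans[of "lend S" "ereal x" "ereal y"] by (auto simp: mem_ivl_iff)
    then show "((\<lambda>x. (z - \<zeta>) * (f x * g x * of_real (coeff_w S x))) has_integral wronskian f F g G y - wronskian f F g G x) {x..y}"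
      using wronskian_has_integral[OF f g] xy(2) by blast
  qed
qed

text \<open>Members of \<open>Dmax\<close> vanish outside the interval, while
  \<open>solution\<close> leaves the values there arbitrary.\<close>

definition zero_ext :: "'z sl_expr_scheme \<Rightarrow> (real \<Rightarrow> complex) \<Rightarrow> real \<Rightarrow> complex" where
  "zero_ext S f x = (if x \<in> ivl S then f x else 0)"

text \<open>The limit-circle conditions cover neighbourhoods of both ends; on the compact remainder
  \<open>f\<close> is bounded and w is integrable.\<close>

lemma solution_in_L2:
  assumes co: "sl_coefficients S" and lc: "limit_circle_a S" "limit_circle_b S" and f: "sl_pair S z f F"
  shows "f \<in> L2 S"
proof -
  have cont: "continuous_on (ivl S) f" using f by (simp add: sl_pair_def AC_loc_imp_continuous_on)
  obtain c d where c: "c \<in> ivl S" "d \<in> ivl S"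
    "set_integrable lebesgue (einterval (lend S) (ereal c)) (\<lambda>x. (norm (f x))\<^sup>2 * coeff_w S x)"
    "set_integrable lebesgue (einterval (ereal d) (rend S)) (\<lambda>x. (norm (f x))\<^sup>2 * coeff_w S x)"
    using lc sl_pair_imp_solution[OF co f]
    unfolding limit_circle_b_def integrable_near_b_def limit_circle_a_def integrable_near_a_def by blast
  have mid: "set_integrable lebesgue {c..d} (\<lambda>x. (norm (f x))\<^sup>2 * coeff_w S x)"
  \<comment> \<open>The two neighbourhoods may overlap, in which case the remainder is
    empty.\<close>
  proof (cases "c \<le> d")
    case True
    have sub: "{c..d} \<subseteq> ivl S" by (rule atLeastAtMost_subset_ivl[OF c(1,2)])
    have w: "set_integrable lebesgue {c..d} (coeff_w S)"
      using co c True unfolding sl_coefficients_def L1_loc_def by blast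
    have cn: "continuous_on {c..d} (\<lambda>x. (norm (f x))\<^sup>2)"
      by (intro continuous_intros continuous_on_subset[OF cont sub])
    then obtain M where M: "\<And>x. x \<in> {c..d} \<Longrightarrow> norm ((norm (f x))\<^sup>2) \<le> M"
      using compact_imp_bounded[OF compact_continuous_image[OF cn]] unfolding bounded_iff by (metis compact_Icc imageI)
    have "set_integrable lebesgue {c..d} (\<lambda>x. M * coeff_w S x)"
      using w by (intro set_integrable_mult_right)
    then show ?thesis
    proof (rule set_integrable_bound)
      have "(\<lambda>x. indicator {c..d} x *\<^sub>R (norm (f x))\<^sup>2) \<in> borel_measurable lebesgue"
        using borel_measurable_continuous_on_indicator[OF _ cn] by (simp add: measurable_completion)
      moreover have "(\<lambda>x. indicator {c..d} x *\<^sub>R coeff_w S x) \<in> borel_measurable lebesgue"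
        using w unfolding set_integrable_def by (rule borel_measurable_integrable)
      ultimately have "(\<lambda>x. (indicator {c..d} x *\<^sub>R (norm (f x))\<^sup>2) * (indicator {c..d} x *\<^sub>R coeff_w S x)) \<in> borel_measurable lebesgue"
        by (rule borel_measurable_times)
      also have "(\<lambda>x. (indicator {c..d} x *\<^sub>R (norm (f x))\<^sup>2) * (indicator {c..d} x *\<^sub>R coeff_w S x)) = (\<lambda>x. indicator {c..d} x *\<^sub>R ((norm (f x))\<^sup>2 * coeff_w S x))"
        by (auto simp: fun_eq_iff indicator_def)
      finally show "set_borel_measurable lebesgue {c..d} (\<lambda>x. (norm (f x))\<^sup>2 * coeff_w S x)"
        unfolding set_borel_measurable_def .
      have "norm ((norm (f x))\<^sup>2 * coeff_w S x) \<le> norm (M * coeff_w S x)" if "x \<in> {c..d}" for x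
        unfolding norm_mult using M[OF that] by (intro mult_right_mono) auto
      then show "AE x in lebesgue. x \<in> {c..d} \<longrightarrow> norm ((norm (f x))\<^sup>2 * coeff_w S x) \<le> norm (M * coeff_w S x)"
        by (intro AE_I2) blast
    qed
  qed (simp add: set_integrable_def)
  have "ivl S = einterval (lend S) (ereal c) \<union> {c..d} \<union> einterval (ereal d) (rend S)"
  proof (rule set_eqI)
    fix x
    show "x \<in> ivl S \<longleftrightarrow> x \<in> einterval (lend S) (ereal c) \<union> {c..d} \<union> einterval (ereal d) (rend S)"
      using c(1,2) less_trans[of "ereal x" "ereal c" "rend S"] less_trans[of "lend S" "ereal d" "ereal x"]
        less_le_trans[of "lend S" "ereal c" "ereal x"] le_less_trans[of "ereal x" "ereal d" "rend S"]
      by (auto simp: mem_ivl_iff einterval_def)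
  qed
  then have "set_integrable lebesgue (ivl S) (\<lambda>x. (norm (f x))\<^sup>2 * coeff_w S x)"
    using set_integrable_Un[OF set_integrable_Un[OF c(3) mid] c(4)] by simp
  with set_borel_measurable_continuous_ivl[OF cont] show ?thesis unfolding L2_def by simp
qed

text \<open>For a solution, \<open>ell\<close> is almost everywhere z times the function, so it
  inherits square integrability.\<close>

lemma zero_ext_in_Dmax:
  assumes co: "sl_coefficients S" and lc: "limit_circle_a S" "limit_circle_b S" and f: "sl_pair S z f F"
  shows "zero_ext S f \<in> Dmax S"
proof -
  have P: "sl_pair S z (zero_ext S f) F"
    by (rule sl_pair_cong[OF f]) (auto simp: zero_ext_def)
  let ?f = "zero_ext S f"
  note sol = sl_pair_imp_solution[OF co P]
  have L2: "?f \<in> L2 S" by (rule solution_in_L2[OF co lc P])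
  have ae: "AE x in lebesgue. x \<in> ivl S \<longrightarrow> ell S ?f x = z * ?f x" using sol unfolding solution_def by simp
  have "(\<lambda>x. indicator (ivl S) x *\<^sub>R ?f x) \<in> borel_measurable lebesgue"
    using L2 unfolding L2_def set_borel_measurable_def by simp
  then have "(\<lambda>x. z * (indicator (ivl S) x *\<^sub>R ?f x)) \<in> borel_measurable lebesgue"
    by (intro borel_measurable_times borel_measurable_const)
  moreover have "AE x in lebesgue. z * (indicator (ivl S) x *\<^sub>R ?f x) = indicator (ivl S) x *\<^sub>R ell S ?f x"
    using ae by eventually_elim (auto simp: indicator_def)
  \<comment> \<open>Almost everywhere equality transfers measurability because
    \<open>lebesgue\<close> is complete.\<close>
  ultimately have m: "set_borel_measurable lebesgue (ivl S) (ell S ?f)"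
    unfolding set_borel_measurable_def by (rule borel_measurable_AE)
  have "set_integrable lebesgue (ivl S) (\<lambda>x. (norm z)\<^sup>2 * ((norm (?f x))\<^sup>2 * coeff_w S x))"
    using L2 unfolding L2_def by (intro set_integrable_mult_right) simp
  then have i: "integrable lebesgue (\<lambda>x. indicator (ivl S) x *\<^sub>R ((norm z)\<^sup>2 * ((norm (?f x))\<^sup>2 * coeff_w S x)))"
    unfolding set_integrable_def .
  have ae': "AE x in lebesgue. indicator (ivl S) x *\<^sub>R ((norm z)\<^sup>2 * ((norm (?f x))\<^sup>2 * coeff_w S x))
    = indicator (ivl S) x *\<^sub>R ((norm (ell S ?f x))\<^sup>2 * coeff_w S x)"
    using ae by eventually_elim (auto simp: indicator_def norm_mult power_mult_distrib)
  have "set_integrable lebesgue (ivl S) (\<lambda>x. (norm (ell S ?f x))\<^sup>2 * coeff_w S x)"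
    unfolding set_integrable_def
    by (rule integrable_cong_AE_imp[OF i borel_measurable_AE[OF borel_measurable_integrable[OF i] ae']])
      (use ae' in \<open>eventually_elim, simp\<close>)
  with m L2 sol show ?thesis
    unfolding Dmax_def L2_def solution_def by (simp add: zero_ext_def)
qed

section \<open>Boundary values and eigenspaces\<close>

text \<open>Conjugation fixes a real solution with real parameter, hence also its unique p u'. This
  removes the conjugates from \<open>bracket\<close>.\<close>

lemma pderiv_of_real:
  assumes co: "sl_coefficients S" and u: "solution S (of_real \<mu>) (cfun u)" and x: "x \<in> ivl S"
  shows "cnj (pderiv_of S (cfun u) x) = pderiv_of S (cfun u) x"
proof -
  have "sl_pair S (of_real \<mu>) (cfun u) (\<lambda>x. cnj (pderiv_of S (cfun u) x))"
    using sl_pair_cnj[OF solution_imp_sl_pair[OF co u]] by simp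
  from sl_pair_pderiv_of[OF co this x] show ?thesis by simp
qed

text \<open>The filter \<open>E\<close> stands for the approach to either endpoint, so that boundary
  values at a and at b are treated by the same argument.\<close>

locale sl_endpoint =
  fixes S :: "'z sl_expr_scheme" and E :: "ereal filter"
  assumes coeffs: "sl_coefficients S"
    and nontrivial: "E \<noteq> bot"
    and eventually_ivl: "eventually (\<lambda>x. real_of_ereal x \<in> ivl S) E"
    and wronskian_convergent: "sl_pair S z f F \<Longrightarrow> sl_pair S \<zeta> g G \<Longrightarrow>
       \<exists>L. ((wronskian f F g G \<circ> real_of_ereal) \<longlongrightarrow> L) E"
begin

definition br :: "(real \<Rightarrow> complex) \<Rightarrow> (real \<Rightarrow> real) \<Rightarrow> complex" where
  "br f u = Lim E (bracket S f (cfun u) \<circ> real_of_ereal)"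

lemma tendsto_ivl_cong:
  fixes g h :: "real \<Rightarrow> complex"
  assumes "((g \<circ> real_of_ereal) \<longlongrightarrow> L) E" "\<And>x. x \<in> ivl S \<Longrightarrow> h x = g x"
  shows "((h \<circ> real_of_ereal) \<longlongrightarrow> L) E"
proof (rule Lim_transform_eventually[OF assms(1)])
  show "eventually (\<lambda>x. (g \<circ> real_of_ereal) x = (h \<circ> real_of_ereal) x) E"
    using eventually_ivl by eventually_elim (simp add: assms(2))
qed

text \<open>For real \<open>u\<close> the bracket coincides with the Wronskian on the interval, and
  the latter converges. Only with this is the \<open>Lim\<close> in \<open>br\<close> a limit, which
  the algebra of boundary values presupposes.\<close>

lemma br_tendsto:
  assumes f: "sl_pair S z f F" and u: "solution S (of_real \<mu>) (cfun u)"
  shows "((wronskian f F (cfun u) (pderiv_of S (cfun u)) \<circ> real_of_ereal) \<longlongrightarrow> br f u) E"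
proof -
  let ?W = "wronskian f F (cfun u) (pderiv_of S (cfun u))"
  obtain L where L: "((?W \<circ> real_of_ereal) \<longlongrightarrow> L) E"
    using wronskian_convergent[OF f solution_imp_sl_pair[OF coeffs u]] by blast
  have "((bracket S f (cfun u) \<circ> real_of_ereal) \<longlongrightarrow> L) E"
    by (rule tendsto_ivl_cong[OF L])
      (simp add: bracket_def wronskian_def sl_pair_pderiv_of[OF coeffs f] pderiv_of_real[OF coeffs u])
  then have "br f u = L" unfolding br_def by (rule tendsto_Lim[OF nontrivial])
  with L show ?thesis by simp
qed

lemma br_eqI:
  assumes f: "sl_pair S z f F" and u: "solution S (of_real \<mu>) (cfun u)"
    and h: "((h \<circ> real_of_ereal) \<longlongrightarrow> L) E"
    and eq: "\<And>x. x \<in> ivl S \<Longrightarrow> wronskian f F (cfun u) (pderiv_of S (cfun u)) x = h x"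
  shows "br f u = L"
  using tendsto_unique[OF nontrivial br_tendsto[OF f u] tendsto_ivl_cong[OF h eq]] .

lemma br_lincomb:
  assumes f: "sl_pair S z f F" and g: "sl_pair S z g G" and u: "solution S (of_real \<mu>) (cfun u)"
    and h: "\<And>x. x \<in> ivl S \<Longrightarrow> h x = \<alpha> * f x + \<beta> * g x"
  shows "br h u = \<alpha> * br f u + \<beta> * br g u"
proof (rule br_eqI[OF sl_pair_cong[OF sl_pair_lincomb[OF f g] h] u])
  let ?W = "\<lambda>f F. wronskian f F (cfun u) (pderiv_of S (cfun u))"
  show "(((\<lambda>x. \<alpha> * ?W f F x + \<beta> * ?W g G x) \<circ> real_of_ereal) \<longlongrightarrow> \<alpha> * br f u + \<beta> * br g u) E"
    unfolding comp_def
    by (intro tendsto_intros br_tendsto[OF f u, unfolded comp_def] br_tendsto[OF g u, unfolded comp_def])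
  show "\<And>x. x \<in> ivl S \<Longrightarrow> ?W h (\<lambda>x. \<alpha> * F x + \<beta> * G x) x = \<alpha> * ?W f F x + \<beta> * ?W g G x"
    by (simp add: wronskian_def h algebra_simps)
qed simp_all

lemma br_cnj:
  assumes f: "sl_pair S z f F" and u: "solution S (of_real \<mu>) (cfun u)"
  shows "br (\<lambda>x. cnj (f x)) u = cnj (br f u)"
proof (rule br_eqI[OF sl_pair_cnj[OF f] u])
  let ?W = "wronskian f F (cfun u) (pderiv_of S (cfun u))"
  show "(((\<lambda>x. cnj (?W x)) \<circ> real_of_ereal) \<longlongrightarrow> cnj (br f u)) E"
    unfolding comp_def by (intro tendsto_cnj br_tendsto[OF f u, unfolded comp_def])
  show "\<And>x. x \<in> ivl S \<Longrightarrow> wronskian (\<lambda>x. cnj (f x)) (\<lambda>x. cnj (F x)) (cfun u) (pderiv_of S (cfun u)) x = cnj (?W x)"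
    by (simp add: wronskian_def pderiv_of_real[OF coeffs u])
qed

text \<open>The limit of the Pluecker relation
  \<open>W(f,g) W(u,v) = W(f,u) W(g,v) - W(f,v) W(g,u)\<close>, in which \<open>W(f,g)\<close> is constant.\<close>

lemma br_wronskian:
  assumes f: "sl_pair S z f F" and g: "sl_pair S z g G"
    and u: "solution S (of_real \<mu>) (cfun u)" and v: "solution S (of_real \<mu>) (cfun v)"
    and uv: "br (cfun u) v = 1" and x: "x \<in> ivl S"
  shows "wronskian f F g G x = br f u * br g v - br f v * br g u"
proof -
  let ?W = "\<lambda>f F u. wronskian f F (cfun u) (pderiv_of S (cfun u))"
  note t = br_tendsto[OF f u] br_tendsto[OF g v] br_tendsto[OF f v] br_tendsto[OF g u]
    br_tendsto[OF solution_imp_sl_pair[OF coeffs u] v]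
  have "(((\<lambda>y. wronskian f F g G x * ?W (cfun u) (pderiv_of S (cfun u)) v y) \<circ> real_of_ereal) \<longlongrightarrow> wronskian f F g G x * br (cfun u) v) E"
    unfolding comp_def by (intro tendsto_intros t[unfolded comp_def])
  moreover have "(((\<lambda>y. ?W f F u y * ?W g G v y - ?W f F v y * ?W g G u y) \<circ> real_of_ereal) \<longlongrightarrow> br f u * br g v - br f v * br g u) E"
    unfolding comp_def by (intro tendsto_intros t[unfolded comp_def])
  moreover have "wronskian f F g G x * ?W (cfun u) (pderiv_of S (cfun u)) v y = ?W f F u y * ?W g G v y - ?W f F v y * ?W g G u y"
    if "y \<in> ivl S" for y
    unfolding wronskian_const[OF f g x that] by (simp add: wronskian_def algebra_simps)
  ultimately have "wronskian f F g G x * br (cfun u) v = br f u * br g v - br f v * br g u"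
    using tendsto_unique[OF nontrivial _ tendsto_ivl_cong] by blast
  with uv show ?thesis by simp
qed

end

lemma sl_endpoint_a:
  assumes co: "sl_coefficients S" and lc: "limit_circle_a S"
  shows "sl_endpoint S (at_right (lend S))"
proof
  have ab: "lend S < rend S" using co by (simp add: sl_coefficients_def)
  show "at_right (lend S) \<noteq> bot"
    unfolding trivial_limit_def eventually_at_right[OF ab] using dense by blast
  show "eventually (\<lambda>x. real_of_ereal x \<in> ivl S) (at_right (lend S))"
    unfolding eventually_at_right[OF ab]
  proof (intro exI[of _ "rend S"] conjI ab allI impI)
    fix y assume "lend S < y" "y < rend S"
    then show "real_of_ereal y \<in> ivl S" by (cases y) (auto simp: mem_ivl_iff)
  qed
qed (use assms wronskian_tendsto_a in blast)+

lemma sl_endpoint_b: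
  assumes co: "sl_coefficients S" and lc: "limit_circle_b S"
  shows "sl_endpoint S (at_left (rend S))"
proof
  have ab: "lend S < rend S" using co by (simp add: sl_coefficients_def)
  show "at_left (rend S) \<noteq> bot"
    unfolding trivial_limit_def eventually_at_left[OF ab] using dense by blast
  show "eventually (\<lambda>x. real_of_ereal x \<in> ivl S) (at_left (rend S))"
    unfolding eventually_at_left[OF ab]
  proof (intro exI[of _ "lend S"] conjI ab allI impI)
    fix y assume "lend S < y" "y < rend S"
    then show "real_of_ereal y \<in> ivl S" by (cases y) (auto simp: mem_ivl_iff)
  qed
qed (use assms wronskian_tendsto_b in blast)+

section \<open>Self-adjoint relations and the two parametrisations of the extensions\<close>

text \<open>Being its own adjoint, \<open>\<theta>\<close> is cut out by conditions that are
  conjugate-linear in the pair.\<close>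

lemma selfadjoint_relation_lincomb:
  assumes "selfadjoint_relation \<theta>" "(x, y) \<in> \<theta>" "(x', y') \<in> \<theta>"
  shows "(\<alpha> *s x + \<beta> *s x', \<alpha> *s y + \<beta> *s y') \<in> \<theta>"
proof -
  have iff: "(h, k) \<in> \<theta> \<longleftrightarrow> (\<forall>(f, g)\<in>\<theta>. cdot g h = cdot f k)" for h k
  proof -
    have "(h, k) \<in> \<theta> \<longleftrightarrow> (h, k) \<in> rel_adjoint \<theta>"
      using assms(1) unfolding selfadjoint_relation_def by simp
    then show ?thesis by (simp add: rel_adjoint_def)
  qed
  have lin: "cdot g (\<alpha> *s h + \<beta> *s h') = cnj \<alpha> * cdot g h + cnj \<beta> * cdot g h'" for g h h'
    by (simp add: cdot_def sum_2 algebra_simps)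
  have "\<forall>(f, g)\<in>\<theta>. cdot g x = cdot f y" "\<forall>(f, g)\<in>\<theta>. cdot g x' = cdot f y'"
    using assms(2,3) by (simp_all only: iff[symmetric])
  then have "\<forall>(f, g)\<in>\<theta>. cdot g (\<alpha> *s x + \<beta> *s x') = cdot f (\<alpha> *s y + \<beta> *s y')"
    by (fastforce simp: lin)
  then show ?thesis by (simp only: iff)
qed

text \<open>The pair of \<open>\<Gamma>0'\<close> and \<open>\<Gamma>1'\<close> is that of
  \<open>\<Gamma>0\<close> and \<open>\<Gamma>1\<close> turned by the map behind
  \<open>neg_rel_inverse\<close>, up to a common sign, which linearity of \<open>\<theta>\<close>
  absorbs.\<close>

lemma dom_Ltilde_neg_rel_inverse:
  assumes "selfadjoint_relation \<theta>"
  shows "dom_Ltilde S (neg_rel_inverse \<theta>) = dom_L S \<theta>"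
proof -
  have "(- y, x) \<in> neg_rel_inverse \<theta> \<longleftrightarrow> (x, y) \<in> \<theta>" for x y
  proof -
    have neg: "(- x, - y) \<in> \<theta>" if "(x, y) \<in> \<theta>" for x y
    proof -
      have "(-1) *s x + 0 *s x = - x" "(-1) *s y + 0 *s y = - y" by (simp_all add: vec_eq_iff)
      with selfadjoint_relation_lincomb[OF assms that that, of "-1" 0] show ?thesis by simp
    qed
    have "(- y, x) \<in> neg_rel_inverse \<theta> \<longleftrightarrow> (- x, - y) \<in> \<theta>"
    proof
      assume "(- y, x) \<in> neg_rel_inverse \<theta>"
      then obtain s t where "- y = t" "x = - s" "(s, t) \<in> \<theta>" unfolding neg_rel_inverse_def by blast
      then show "(- x, - y) \<in> \<theta>" by simp
    next
      assume "(- x, - y) \<in> \<theta>"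
      then have "(- y, - (- x)) \<in> neg_rel_inverse \<theta>" unfolding neg_rel_inverse_def by blast
      then show "(- y, x) \<in> neg_rel_inverse \<theta>" by simp
    qed
    then show ?thesis using neg[of x y] neg[of "- x" "- y"] by auto
  qed
  then show ?thesis unfolding dom_Ltilde_def dom_L_def \<Gamma>0'_def \<Gamma>1'_def by simp
qed

locale sl_bvp =
  fixes S :: "'z sl_system_scheme"
  assumes coeffs: "sl_coefficients S"
    and lc: "limit_circle_a S" "limit_circle_b S"
    and bsol: "boundary_solutions S" and fsol: "fundamental_solutions S"
begin

sublocale a: sl_endpoint S "at_right (lend S)" by (rule sl_endpoint_a[OF coeffs lc(1)])
sublocale b: sl_endpoint S "at_left (rend S)" by (rule sl_endpoint_b[OF coeffs lc(2)])

lemma boundary_solution: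
  "solution S (of_real (lam0 S)) (cfun (sol_ua S))" "solution S (of_real (lam0 S)) (cfun (sol_va S))"
  "solution S (of_real (lam0 S)) (cfun (sol_ub S))" "solution S (of_real (lam0 S)) (cfun (sol_vb S))"
  using bsol unfolding boundary_solutions_def principal_a_def principal_b_def nonprincipal_a_def
    nonprincipal_b_def real_solution_def by auto

lemma qd_eq_br:
  "qd0_a S f = a.br f (sol_va S)" "qd1_a S f = - a.br f (sol_ua S)"
  "qd0_b S f = b.br f (sol_vb S)" "qd1_b S f = - b.br f (sol_ub S)"
  by (simp_all add: qd0_a_def qd1_a_def qd0_b_def qd1_b_def a.br_def b.br_def bracket_a_def bracket_b_def)

lemma br_normalised: "a.br (cfun (sol_ua S)) (sol_va S) = 1" "b.br (cfun (sol_ub S)) (sol_vb S) = 1"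
  using bsol unfolding boundary_solutions_def by (simp_all add: a.br_def b.br_def bracket_a_def bracket_b_def)

text \<open>The same constant is read off at either endpoint; comparing the two expressions carries
  information from a to b.\<close>

lemma wronskian_qd:
  assumes f: "sl_pair S z f F" and g: "sl_pair S z g G" and x: "x \<in> ivl S"
  shows "wronskian f F g G x = qd0_a S f * qd1_a S g - qd1_a S f * qd0_a S g"
    and "wronskian f F g G x = qd0_b S f * qd1_b S g - qd1_b S f * qd0_b S g"
  using a.br_wronskian[OF f g boundary_solution(1,2) br_normalised(1) x]
    b.br_wronskian[OF f g boundary_solution(3,4) br_normalised(2) x]
  by (simp_all add: qd_eq_br)

definition e1 :: "complex \<Rightarrow> real \<Rightarrow> complex" where "e1 z = zero_ext S (sol_u1 S z)"
definition e2 :: "complex \<Rightarrow> real \<Rightarrow> complex" where "e2 z = zero_ext S (sol_u2 S z)"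
text \<open>Coordinates on the solution space: \<alpha> and \<beta> turn out to be the boundary
  values at a, so they are determined by the function.\<close>

definition comb :: "complex \<Rightarrow> complex \<Rightarrow> complex \<Rightarrow> real \<Rightarrow> complex" where
  "comb z \<alpha> \<beta> = (\<lambda>x. \<alpha> * e1 z x + \<beta> * e2 z x)"

lemma fundamental:
  "sl_pair S z (sol_u1 S z) (pderiv_of S (sol_u1 S z))" "sl_pair S z (sol_u2 S z) (pderiv_of S (sol_u2 S z))"
  "qd0_a S (sol_u1 S z) = 1" "qd1_a S (sol_u1 S z) = 0" "qd0_a S (sol_u2 S z) = 0" "qd1_a S (sol_u2 S z) = 1"
  using fsol solution_imp_sl_pair[OF coeffs] unfolding fundamental_solutions_def by blast+

lemma comb_eq: "x \<in> ivl S \<Longrightarrow> comb z \<alpha> \<beta> x = \<alpha> * sol_u1 S z x + \<beta> * sol_u2 S z x"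
  by (simp add: comb_def e1_def e2_def zero_ext_def)

lemma e_eq_comb: "e1 z = comb z 1 0" "e2 z = comb z 0 1"
  by (simp_all add: comb_def)

lemma comb_zero: "comb z 0 0 = 0"
  by (simp add: comb_def fun_eq_iff)

lemma comb_lincomb: "(\<lambda>x. \<gamma> * comb z \<alpha> \<beta> x + \<delta> * comb z \<alpha>' \<beta>' x) = comb z (\<gamma> * \<alpha> + \<delta> * \<alpha>') (\<gamma> * \<beta> + \<delta> * \<beta>')"
  by (simp add: comb_def fun_eq_iff algebra_simps)

lemma comb_sl_pair:
  "sl_pair S z (comb z \<alpha> \<beta>) (\<lambda>x. \<alpha> * pderiv_of S (sol_u1 S z) x + \<beta> * pderiv_of S (sol_u2 S z) x)"
  by (rule sl_pair_cong[OF sl_pair_lincomb[OF fundamental(1,2)]]) (simp_all add: comb_eq)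

lemma comb_in_Dmax: "comb z \<alpha> \<beta> \<in> Dmax S"
proof -
  have "zero_ext S (comb z \<alpha> \<beta>) = comb z \<alpha> \<beta>"
    by (simp add: fun_eq_iff zero_ext_def comb_def e1_def e2_def)
  with zero_ext_in_Dmax[OF coeffs lc comb_sl_pair] show ?thesis by metis
qed

lemma comb_ell: "AE x in lebesgue. x \<in> ivl S \<longrightarrow> ell S (comb z \<alpha> \<beta>) x = z * comb z \<alpha> \<beta> x"
  using sl_pair_imp_solution[OF coeffs comb_sl_pair] unfolding solution_def by blast

lemma qd_comb:
  "qd0_a S (comb z \<alpha> \<beta>) = \<alpha>" "qd1_a S (comb z \<alpha> \<beta>) = \<beta>"
  "qd0_b S (comb z \<alpha> \<beta>) = \<alpha> * qd0_b S (sol_u1 S z) + \<beta> * qd0_b S (sol_u2 S z)"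
  "qd1_b S (comb z \<alpha> \<beta>) = \<alpha> * qd1_b S (sol_u1 S z) + \<beta> * qd1_b S (sol_u2 S z)"
proof -
  have ua: "a.br (sol_u1 S z) (sol_ua S) = 0" "a.br (sol_u2 S z) (sol_ua S) = -1"
    using fundamental(4,6)[of z] unfolding qd_eq_br by (simp, metis minus_minus)
  have va: "a.br (sol_u1 S z) (sol_va S) = 1" "a.br (sol_u2 S z) (sol_va S) = 0"
    using fundamental(3,5)[of z] unfolding qd_eq_br .
  have A: "a.br (comb z \<alpha> \<beta>) u = \<alpha> * a.br (sol_u1 S z) u + \<beta> * a.br (sol_u2 S z) u"
    if "solution S (of_real \<nu>) (cfun u)" for u \<nu>
    by (rule a.br_lincomb[OF fundamental(1,2) that]) (rule comb_eq)
  have B: "b.br (comb z \<alpha> \<beta>) u = \<alpha> * b.br (sol_u1 S z) u + \<beta> * b.br (sol_u2 S z) u"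
    if "solution S (of_real \<nu>) (cfun u)" for u \<nu>
    by (rule b.br_lincomb[OF fundamental(1,2) that]) (rule comb_eq)
  show "qd0_a S (comb z \<alpha> \<beta>) = \<alpha>" "qd1_a S (comb z \<alpha> \<beta>) = \<beta>"
    using A[OF boundary_solution(1)] A[OF boundary_solution(2)] ua va by (simp_all add: qd_eq_br)
  show "qd0_b S (comb z \<alpha> \<beta>) = \<alpha> * qd0_b S (sol_u1 S z) + \<beta> * qd0_b S (sol_u2 S z)"
    "qd1_b S (comb z \<alpha> \<beta>) = \<alpha> * qd1_b S (sol_u1 S z) + \<beta> * qd1_b S (sol_u2 S z)"
    using B[OF boundary_solution(3)] B[OF boundary_solution(4)] by (simp_all add: qd_eq_br)
qed

lemma comb_inject: "comb z \<alpha> \<beta> = comb z \<alpha>' \<beta>' \<longleftrightarrow> \<alpha> = \<alpha>' \<and> \<beta> = \<beta>'"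
  by (metis qd_comb(1,2))

text \<open>The Wronskian of u_1 and u_2 is 1 by the normalisation at a; this is the same constant
  expressed at b.\<close>

lemma fundamental_det:
  "qd0_b S (sol_u1 S z) * qd1_b S (sol_u2 S z) - qd1_b S (sol_u1 S z) * qd0_b S (sol_u2 S z) = 1"
proof -
  obtain x where x: "x \<in> ivl S"
    using ereal_dense2[of "lend S" "rend S"] coeffs by (auto simp: mem_ivl_iff sl_coefficients_def)
  show ?thesis using wronskian_qd[OF fundamental(1,2) x] fundamental(3-6)[of z] by simp
qed

text \<open>Cramer's rule for the vectors (f, p f') at each point. Its coefficients W(f, u_2) and
  W(u_1, f) are constant, and evaluated at a they are f^[0](a) and f^[1](a).\<close>

lemma solution_eq_comb:
  assumes f: "solution S z f" and 0: "\<And>x. x \<notin> ivl S \<Longrightarrow> f x = 0"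
  shows "f = comb z (qd0_a S f) (qd1_a S f)"
proof
  fix x
  show "f x = comb z (qd0_a S f) (qd1_a S f) x"
  proof (cases "x \<in> ivl S")
    case True
    let ?F = "pderiv_of S f" and ?u1 = "sol_u1 S z" and ?u2 = "sol_u2 S z"
    let ?U1 = "pderiv_of S ?u1" and ?U2 = "pderiv_of S ?u2"
    note P = solution_imp_sl_pair[OF coeffs f]
    have "f x * wronskian ?u1 ?U1 ?u2 ?U2 x = wronskian f ?F ?u2 ?U2 x * ?u1 x + wronskian ?u1 ?U1 f ?F x * ?u2 x"
      by (simp add: wronskian_def algebra_simps)
    then show ?thesis
      using wronskian_qd(1)[OF fundamental(1,2) True] wronskian_qd(1)[OF P fundamental(2) True]
        wronskian_qd(1)[OF fundamental(1) P True] fundamental(3-6)[of z]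
      by (simp add: comb_eq[OF True])
  qed (simp add: 0 comb_def e1_def e2_def zero_ext_def)
qed

lemma eigenspace_iff:
  assumes "D \<subseteq> Dmax S"
  shows "f \<in> eigenspace S D z \<longleftrightarrow> f \<in> D \<and> (\<exists>\<alpha> \<beta>. f = comb z \<alpha> \<beta>)"
proof -
  have "\<exists>\<alpha> \<beta>. f = comb z \<alpha> \<beta>" if "f \<in> D" "AE x in lebesgue. x \<in> ivl S \<longrightarrow> ell S f x = z * f x"
  proof -
    have "solution S z f" "\<And>x. x \<notin> ivl S \<Longrightarrow> f x = 0"
      using that assms unfolding solution_def Dmax_def by auto
    from solution_eq_comb[OF this] show ?thesis by blast
  qed
  then show ?thesis unfolding eigenspace_def using comb_ell by auto
qed

text \<open>For a real parameter the conjugate is again a solution, with conjugated boundary values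
  at a; the values 0 and 1 are real.\<close>

lemma cnj_e: "(\<lambda>x. cnj (e1 (of_real \<mu>) x)) = e1 (of_real \<mu>)" "(\<lambda>x. cnj (e2 (of_real \<mu>) x)) = e2 (of_real \<mu>)"
proof -
  have *: "(\<lambda>x. cnj (comb (of_real \<mu>) \<alpha> \<beta> x)) = comb (of_real \<mu>) (cnj \<alpha>) (cnj \<beta>)" for \<alpha> \<beta>
  proof -
    let ?f = "\<lambda>x. cnj (comb (of_real \<mu>) \<alpha> \<beta> x)"
    have "solution S (of_real \<mu>) ?f"
      using sl_pair_imp_solution[OF coeffs sl_pair_cnj[OF comb_sl_pair[of "of_real \<mu>"]]] by simp
    then have "?f = comb (of_real \<mu>) (qd0_a S ?f) (qd1_a S ?f)"
      by (rule solution_eq_comb) (simp add: comb_def e1_def e2_def zero_ext_def)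
    moreover have "qd0_a S ?f = cnj \<alpha>" "qd1_a S ?f = cnj \<beta>"
      using qd_comb(1,2)[of "of_real \<mu>" \<alpha> \<beta>]
      by (simp_all add: qd_eq_br a.br_cnj[OF comb_sl_pair boundary_solution(1)] a.br_cnj[OF comb_sl_pair boundary_solution(2)]
        flip: complex_cnj_minus)
    ultimately show ?thesis by (simp only:)
  qed
  show "(\<lambda>x. cnj (e1 (of_real \<mu>) x)) = e1 (of_real \<mu>)" "(\<lambda>x. cnj (e2 (of_real \<mu>) x)) = e2 (of_real \<mu>)"
    using *[of 1 0] *[of 0 1] by (simp_all add: e_eq_comb)
qed

text \<open>These are the denominators in (i) and (ii). Their reality turns the conjugate of the
  lower off-diagonal entry into that entry itself.\<close>

lemma qd_b_real:
  "cnj (qd0_b S (sol_u2 S (of_real \<mu>))) = qd0_b S (sol_u2 S (of_real \<mu>))"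
  "cnj (qd1_b S (sol_u1 S (of_real \<mu>))) = qd1_b S (sol_u1 S (of_real \<mu>))"
proof -
  let ?z = "of_real \<mu> :: complex"
  have "cnj (b.br (comb ?z 0 1) (sol_vb S)) = b.br (comb ?z 0 1) (sol_vb S)"
    using b.br_cnj[OF comb_sl_pair boundary_solution(4), of ?z 0 1] cnj_e(2)[of \<mu>] by (simp add: e_eq_comb)
  then have "cnj (qd0_b S (comb ?z 0 1)) = qd0_b S (comb ?z 0 1)" by (simp add: qd_eq_br)
  then show "cnj (qd0_b S (sol_u2 S ?z)) = qd0_b S (sol_u2 S ?z)" by (simp add: qd_comb)
  have "cnj (b.br (comb ?z 1 0) (sol_ub S)) = b.br (comb ?z 1 0) (sol_ub S)"
    using b.br_cnj[OF comb_sl_pair boundary_solution(3), of ?z 1 0] cnj_e(1)[of \<mu>] by (simp add: e_eq_comb)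
  then have "cnj (qd1_b S (comb ?z 1 0)) = qd1_b S (comb ?z 1 0)" by (simp add: qd_eq_br)
  then show "cnj (qd1_b S (sol_u1 S ?z)) = qd1_b S (sol_u1 S ?z)" by (simp add: qd_comb)
qed

text \<open>Both \<open>comb z \<alpha> \<beta>\<close> and the zero function, written
  \<open>comb z 0 0\<close>, solve the resolvent equation with right-hand side 0, so uniqueness
  identifies them.\<close>

lemma resolvent_comb_zero:
  assumes z: "z \<in> resolvent_set S D" and 0: "comb z 0 0 \<in> D" and D: "comb z \<alpha> \<beta> \<in> D"
  shows "\<alpha> = 0 \<and> \<beta> = 0"
proof -
  have "(\<lambda>x. 0) \<in> L2 S"
    by (simp add: L2_def set_borel_measurable_def set_integrable_def)
  moreover have "\<forall>g\<in>L2 S. \<exists>!f. f \<in> D \<and> (AE x in lebesgue. x \<in> ivl S \<longrightarrow> ell S f x - z * f x = g x)"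
    using z by (simp add: resolvent_set_def)
  ultimately have "\<exists>!f. f \<in> D \<and> (AE x in lebesgue. x \<in> ivl S \<longrightarrow> ell S f x - z * f x = 0)"
    by (rule bspec[rotated])
  moreover have "AE x in lebesgue. x \<in> ivl S \<longrightarrow> ell S (comb z \<alpha> \<beta>) x - z * comb z \<alpha> \<beta> x = 0" for \<alpha> \<beta>
    using comb_ell[of z \<alpha> \<beta>] by eventually_elim simp
  ultimately have "comb z \<alpha> \<beta> = comb z 0 0"
    using 0 D by blast
  then show ?thesis by (simp add: comb_inject)
qed

lemma \<Gamma>_comb:
  "\<Gamma>0 S (comb z \<alpha> \<beta>) = vector [\<alpha>, \<alpha> * qd0_b S (sol_u1 S z) + \<beta> * qd0_b S (sol_u2 S z)]"
  "\<Gamma>1 S (comb z \<alpha> \<beta>) = vector [\<beta>, - (\<alpha> * qd1_b S (sol_u1 S z) + \<beta> * qd1_b S (sol_u2 S z))]"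
  by (simp_all add: \<Gamma>0_def \<Gamma>1_def qd_comb)

text \<open>A zero would put u_2, already with value 0 at a, into the kernel of
  \<open>\<Gamma>0\<close> and so make it an eigenfunction of L_0.\<close>

lemma resolvent_L0_denominator:
  assumes "z \<in> resolvent_set S (dom_L0 S)"
  shows "qd0_b S (sol_u2 S z) \<noteq> 0"
proof
  assume "qd0_b S (sol_u2 S z) = 0"
  then have "comb z 0 1 \<in> dom_L0 S" "comb z 0 0 \<in> dom_L0 S"
    unfolding dom_L0_def by (simp_all add: comb_in_Dmax \<Gamma>_comb vec_eq_iff forall_2)
  with resolvent_comb_zero[OF assms] show False by fastforce
qed

text \<open>The corresponding argument with u_1, which would lie in the kernel of
  \<open>\<Gamma>1\<close>.\<close>

lemma resolvent_Linf_denominator: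
  assumes "z \<in> resolvent_set S (dom_Linf S)"
  shows "qd1_b S (sol_u1 S z) \<noteq> 0"
proof
  assume "qd1_b S (sol_u1 S z) = 0"
  then have "comb z 1 0 \<in> dom_Linf S" "comb z 0 0 \<in> dom_Linf S"
    unfolding dom_Linf_def by (simp_all add: comb_in_Dmax \<Gamma>_comb vec_eq_iff forall_2)
  with resolvent_comb_zero[OF assms] show False by fastforce
qed

section \<open>Dimension of the eigenspaces\<close>

lemma span_e: "fun_space.span {e1 z, e2 z} = range (\<lambda>(\<alpha>, \<beta>). comb z \<alpha> \<beta>)"
proof
  show "fun_space.span {e1 z, e2 z} \<subseteq> range (\<lambda>(\<alpha>, \<beta>). comb z \<alpha> \<beta>)"
  proof (rule fun_space.span_minimal)
    show "{e1 z, e2 z} \<subseteq> range (\<lambda>(\<alpha>, \<beta>). comb z \<alpha> \<beta>)" by (auto simp: e_eq_comb)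
    show "fun_space.subspace (range (\<lambda>(\<alpha>, \<beta>). comb z \<alpha> \<beta>))"
    proof (rule fun_space.subspaceI)
      show "0 \<in> range (\<lambda>(\<alpha>, \<beta>). comb z \<alpha> \<beta>)" using comb_zero[of z] by (metis case_prod_conv rangeI)
      fix f g c assume "f \<in> range (\<lambda>(\<alpha>, \<beta>). comb z \<alpha> \<beta>)"
      then obtain \<alpha> \<beta> where f: "f = comb z \<alpha> \<beta>" by auto
      show "(\<lambda>x. c * f x) \<in> range (\<lambda>(\<alpha>, \<beta>). comb z \<alpha> \<beta>)"
        using comb_lincomb[of c z \<alpha> \<beta> 0 0 0] f by (auto intro!: image_eqI[of _ _ "(c * \<alpha>, c * \<beta>)"])
      assume "g \<in> range (\<lambda>(\<alpha>, \<beta>). comb z \<alpha> \<beta>)"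
      then obtain \<alpha>' \<beta>' where g: "g = comb z \<alpha>' \<beta>'" by auto
      show "f + g \<in> range (\<lambda>(\<alpha>, \<beta>). comb z \<alpha> \<beta>)"
        using comb_lincomb[of 1 z \<alpha> \<beta> 1 \<alpha>' \<beta>'] f g
        by (auto simp: plus_fun_def intro!: image_eqI[of _ _ "(\<alpha> + \<alpha>', \<beta> + \<beta>')"])
    qed
  qed
  show "range (\<lambda>(\<alpha>, \<beta>). comb z \<alpha> \<beta>) \<subseteq> fun_space.span {e1 z, e2 z}"
  proof (clarify)
    fix \<alpha> \<beta>
    have "(\<lambda>x. \<alpha> * e1 z x) + (\<lambda>x. \<beta> * e2 z x) \<in> fun_space.span {e1 z, e2 z}"
      by (intro fun_space.span_add fun_space.span_scale fun_space.span_base) auto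
    then show "comb z \<alpha> \<beta> \<in> fun_space.span {e1 z, e2 z}" by (simp add: comb_def plus_fun_def)
  qed
qed

lemma independent_e: "fun_space.independent {e1 z, e2 z}" "card {e1 z, e2 z} = 2"
proof -
  have ne: "e1 z \<noteq> e2 z" by (simp add: e_eq_comb comb_inject)
  have "e1 z \<notin> fun_space.span {e2 z}"
  proof
    assume "e1 z \<in> fun_space.span {e2 z}"
    then obtain k where "e1 z = (\<lambda>x. k * e2 z x)" unfolding fun_space.span_singleton by auto
    then have "comb z 1 0 = comb z 0 k" by (simp add: comb_def)
    then show False by (simp add: comb_inject)
  qed
  moreover have "e2 z \<noteq> 0" using comb_inject[of z 0 1 0 0] by (simp add: e_eq_comb comb_zero)
  ultimately show "fun_space.independent {e1 z, e2 z}"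
    by (simp add: fun_space.independent_insert)
  show "card {e1 z, e2 z} = 2" using ne by simp
qed

text \<open>The eigenspace is contained in the plane spanned by \<open>e1 z\<close> and
  \<open>e2 z\<close>; it has dimension two only if it fills that plane.\<close>

lemma multiplicity_eq_2_iff:
  assumes \<theta>: "selfadjoint_relation \<theta>"
  shows "multiplicity_of S (dom_L S \<theta>) z = 2 \<longleftrightarrow> e1 z \<in> dom_L S \<theta> \<and> e2 z \<in> dom_L S \<theta>"
proof -
  let ?E = "eigenspace S (dom_L S \<theta>) z"
  have sub: "dom_L S \<theta> \<subseteq> Dmax S" unfolding dom_L_def by auto
  note E = eigenspace_iff[OF sub]
  have lin: "(\<lambda>x. \<gamma> * f x + \<delta> * g x) \<in> ?E" if "f \<in> ?E" "g \<in> ?E" for f g \<gamma> \<delta>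
  proof -
    from that obtain \<alpha> \<beta> \<alpha>' \<beta>' where fg: "f = comb z \<alpha> \<beta>" "g = comb z \<alpha>' \<beta>'" "f \<in> dom_L S \<theta>" "g \<in> dom_L S \<theta>"
      unfolding E by auto
    have eq: "(\<lambda>x. \<gamma> * f x + \<delta> * g x) = comb z (\<gamma> * \<alpha> + \<delta> * \<alpha>') (\<gamma> * \<beta> + \<delta> * \<beta>')"
      unfolding fg(1,2) by (rule comb_lincomb)
    have "(\<gamma> *s \<Gamma>0 S f + \<delta> *s \<Gamma>0 S g, \<gamma> *s \<Gamma>1 S f + \<delta> *s \<Gamma>1 S g) \<in> \<theta>"
      using fg(3,4) unfolding dom_L_def by (intro selfadjoint_relation_lincomb[OF \<theta>]) auto
    also have "\<gamma> *s \<Gamma>0 S f + \<delta> *s \<Gamma>0 S g = \<Gamma>0 S (comb z (\<gamma> * \<alpha> + \<delta> * \<alpha>') (\<gamma> * \<beta> + \<delta> * \<beta>'))"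
      by (simp add: fg(1,2) \<Gamma>_comb vec_eq_iff forall_2 algebra_simps)
    also have "\<gamma> *s \<Gamma>1 S f + \<delta> *s \<Gamma>1 S g = \<Gamma>1 S (comb z (\<gamma> * \<alpha> + \<delta> * \<alpha>') (\<gamma> * \<beta> + \<delta> * \<beta>'))"
      by (simp add: fg(1,2) \<Gamma>_comb vec_eq_iff forall_2 algebra_simps)
    finally have "comb z (\<gamma> * \<alpha> + \<delta> * \<alpha>') (\<gamma> * \<beta> + \<delta> * \<beta>') \<in> dom_L S \<theta>"
      unfolding dom_L_def using comb_in_Dmax by blast
    then show ?thesis unfolding E eq by blast
  qed
  \<comment> \<open>Any member yields 0 as a combination with zero coefficients; both directions
    below provide one.\<close>
  have subspace: "fun_space.subspace ?E" if "?E \<noteq> {}"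
  proof (rule fun_space.subspaceI)
    from that obtain f where "f \<in> ?E" by auto
    from lin[OF this this, of 0 0] show "0 \<in> ?E" by (simp add: zero_fun_def)
    fix f g c assume f: "f \<in> ?E"
    from lin[OF this this, of c 0] show "(\<lambda>x. c * f x) \<in> ?E" by simp
    assume "g \<in> ?E"
    from lin[OF f this, of 1 1] show "f + g \<in> ?E" by (simp add: plus_fun_def)
  qed
  have Espan: "?E \<subseteq> fun_space.span {e1 z, e2 z}"
    unfolding span_e E subset_iff by (auto intro!: image_eqI[where x = "(_, _)"])
  show ?thesis
  proof
    assume "multiplicity_of S (dom_L S \<theta>) z = 2"
    moreover obtain B where B: "B \<subseteq> ?E" "fun_space.independent B" "?E \<subseteq> fun_space.span B" "card B = fun_space.dim ?E"
      by (rule fun_space.basis_exists)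
    ultimately have card: "card B = 2" unfolding multiplicity_of_def by simp
    then have "?E \<noteq> {}" using B(1) by auto
    then have BE: "fun_space.span B \<subseteq> ?E" using B(1) subspace by (intro fun_space.span_minimal)
    have "e \<in> ?E" if e: "e \<in> {e1 z, e2 z}" for e
    proof (rule ccontr)
      assume "e \<notin> ?E"
      then have n: "e \<notin> fun_space.span B" using BE by auto
      then have "e \<notin> B" using fun_space.span_base by blast
      \<comment> \<open>A missing \<open>e\<close> would enlarge the basis to three independent
        functions inside a plane.\<close>
      with n B(2) have "fun_space.independent (insert e B)" by (simp add: fun_space.independent_insert)
      moreover have "insert e B \<subseteq> fun_space.span {e1 z, e2 z}"
        using e B(1) Espan fun_space.span_base by blast
      ultimately have "card (insert e B) \<le> card {e1 z, e2 z}"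
        using fun_space.independent_span_bound[of "{e1 z, e2 z}" "insert e B"] by simp
      moreover have "finite B" using card by (metis card.infinite zero_neq_numeral)
      ultimately show False using \<open>e \<notin> B\<close> card independent_e(2)[of z] by simp
    qed
    then show "e1 z \<in> dom_L S \<theta> \<and> e2 z \<in> dom_L S \<theta>" unfolding E by simp
  next
    assume "e1 z \<in> dom_L S \<theta> \<and> e2 z \<in> dom_L S \<theta>"
    then have "e1 z \<in> ?E" "e2 z \<in> ?E" unfolding E e_eq_comb by blast+
    then have e: "{e1 z, e2 z} \<subseteq> ?E" by simp
    then have "fun_space.span {e1 z, e2 z} \<subseteq> ?E" using subspace by (intro fun_space.span_minimal) auto
    with Espan have "?E = fun_space.span {e1 z, e2 z}" by auto
    then show "multiplicity_of S (dom_L S \<theta>) z = 2"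
      unfolding multiplicity_of_def using independent_e[of z]
      by (simp add: fun_space.dim_eq_card_independent)
  qed
qed

section \<open>Matrix boundary conditions and degeneracy\<close>

lemma comb_in_dom_L_graph:
  "comb z \<alpha> \<beta> \<in> dom_L S (matrix_graph M) \<longleftrightarrow> \<Gamma>1 S (comb z \<alpha> \<beta>) = M *v \<Gamma>0 S (comb z \<alpha> \<beta>)"
  unfolding dom_L_def matrix_graph_def using comb_in_Dmax by auto

lemma comb_in_dom_Ltilde_graph:
  "comb z \<alpha> \<beta> \<in> dom_Ltilde S (matrix_graph M) \<longleftrightarrow> \<Gamma>0 S (comb z \<alpha> \<beta>) = M *v (- \<Gamma>1 S (comb z \<alpha> \<beta>))"
  unfolding dom_Ltilde_def matrix_graph_def \<Gamma>0'_def \<Gamma>1'_def using comb_in_Dmax by auto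

text \<open>With the prescribed matrix the boundary condition becomes an identity in \<alpha> and
  \<beta>, so every solution satisfies it. The third kind of degeneracy contains the claim.\<close>

lemma degenerate_imp_multiplicity_2:
  assumes \<theta>: "selfadjoint_relation \<theta>" and \<theta>': "\<theta>' = neg_rel_inverse \<theta>"
    and deg: "degenerate S (dom_L S \<theta>) \<theta> \<theta>' \<mu>"
  shows "multiplicity_of S (dom_L S \<theta>) (of_real \<mu>) = 2"
proof -
  let ?z = "of_real \<mu> :: complex"
  let ?A = "qd0_b S (sol_u1 S ?z)" and ?B = "qd0_b S (sol_u2 S ?z)"
    and ?C = "qd1_b S (sol_u1 S ?z)" and ?D = "qd1_b S (sol_u2 S ?z)"
  note det = fundamental_det[of ?z]
  from deg consider "degenerate_i S \<theta> ?z" | "degenerate_ii S \<theta>' ?z" | "multiplicity_of S (dom_L S \<theta>) ?z = 2"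
    unfolding degenerate_def by blast
  then show ?thesis
  proof cases
    case 1
    then obtain M where M: "hermitian_matrix M" "\<theta> = matrix_graph M" "M $ 1 $ 1 = - (?A / ?B)"
      "M $ 2 $ 1 = 1 / ?B" "M $ 2 $ 2 = - (?D / ?B)" and res: "?z \<in> resolvent_set S (dom_L0 S)"
      unfolding degenerate_i_def by blast
    have nz: "?B \<noteq> 0" by (rule resolvent_L0_denominator[OF res])
    \<comment> \<open>The remaining entry is not prescribed by (i); symmetry and the reality of
      \<open>?B\<close> determine it.\<close>
    have "M $ 1 $ 2 = cnj (M $ 2 $ 1)" using M(1) unfolding hermitian_matrix_def by blast
    then have M12: "M $ 1 $ 2 = 1 / ?B" using M(4) qd_b_real(1)[of \<mu>] by simp
    have "comb ?z \<alpha> \<beta> \<in> dom_L S \<theta>" for \<alpha> \<beta>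
    proof -
      have "\<beta> = M $ 1 $ 1 * \<alpha> + M $ 1 $ 2 * (\<alpha> * ?A + \<beta> * ?B)"
        using nz by (simp add: M M12 field_simps)
      moreover have "- (\<alpha> * ?C + \<beta> * ?D) = M $ 2 $ 1 * \<alpha> + M $ 2 $ 2 * (\<alpha> * ?A + \<beta> * ?B)"
      proof -
        \<comment> \<open>The second row, cleared of denominators, holds because
          \<open>?A * ?D - ?C * ?B = 1\<close>; the first row needs only
          \<open>?B \<noteq> 0\<close>.\<close>
        have "- (\<alpha> * ?C + \<beta> * ?D) * ?B = \<alpha> - ?D * (\<alpha> * ?A + \<beta> * ?B)" using det by algebra
        then have "- (\<alpha> * ?C + \<beta> * ?D) = (\<alpha> - ?D * (\<alpha> * ?A + \<beta> * ?B)) / ?B"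
          by (simp only: nonzero_eq_divide_eq[OF nz])
        then show ?thesis by (simp only: M) (simp add: add_divide_distrib diff_divide_distrib)
      qed
      ultimately show ?thesis
        unfolding M(2) comb_in_dom_L_graph
        by (simp add: \<Gamma>_comb vec_eq_iff forall_2 matrix_vector_mult_def sum_2)
    qed
    then show ?thesis unfolding multiplicity_eq_2_iff[OF \<theta>] e_eq_comb by blast
  next
    case 2
    then obtain M where M: "hermitian_matrix M" "\<theta>' = matrix_graph M" "M $ 1 $ 1 = ?D / ?C"
      "M $ 2 $ 1 = 1 / ?C" "M $ 2 $ 2 = ?A / ?C" and res: "?z \<in> resolvent_set S (dom_Linf S)"
      unfolding degenerate_ii_def by blast
    have nz: "?C \<noteq> 0" by (rule resolvent_Linf_denominator[OF res])
    have "M $ 1 $ 2 = cnj (M $ 2 $ 1)" using M(1) unfolding hermitian_matrix_def by blast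
    then have M12: "M $ 1 $ 2 = 1 / ?C" using M(4) qd_b_real(2)[of \<mu>] by simp
    have "comb ?z \<alpha> \<beta> \<in> dom_Ltilde S \<theta>'" for \<alpha> \<beta>
    proof -
      have "\<alpha> = M $ 1 $ 1 * (- \<beta>) + M $ 1 $ 2 * (\<alpha> * ?C + \<beta> * ?D)"
        using nz by (simp add: M M12 field_simps)
      moreover have "\<alpha> * ?A + \<beta> * ?B = M $ 2 $ 1 * (- \<beta>) + M $ 2 $ 2 * (\<alpha> * ?C + \<beta> * ?D)"
      proof -
        \<comment> \<open>Again the determinant identity, now cleared of the denominator
          \<open>?C\<close>.\<close>
        have "(\<alpha> * ?A + \<beta> * ?B) * ?C = - \<beta> + ?A * (\<alpha> * ?C + \<beta> * ?D)" using det by algebra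
        then have "\<alpha> * ?A + \<beta> * ?B = (- \<beta> + ?A * (\<alpha> * ?C + \<beta> * ?D)) / ?C"
          by (simp only: nonzero_eq_divide_eq[OF nz])
        then show ?thesis by (simp only: M) (simp add: add_divide_distrib diff_divide_distrib)
      qed
      moreover have neg: "- \<Gamma>1 S (comb ?z \<alpha> \<beta>) = vector [- \<beta>, \<alpha> * ?C + \<beta> * ?D]"
        by (simp add: \<Gamma>_comb vec_eq_iff forall_2)
      ultimately show ?thesis
        unfolding M(2) comb_in_dom_Ltilde_graph neg
        by (simp add: \<Gamma>_comb vec_eq_iff forall_2 matrix_vector_mult_def sum_2)
    qed
    then show ?thesis
      unfolding multiplicity_eq_2_iff[OF \<theta>] e_eq_comb \<theta>' dom_Ltilde_neg_rel_inverse[OF \<theta>] by blast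
  qed
qed

text \<open>The boundary condition for u_1 and for u_2 gives two equations each, enough to determine
  the four entries of the matrix.\<close>

lemma multiplicity_2_imp_degenerate_i:
  assumes \<theta>: "selfadjoint_relation \<theta>" "is_hermitian_graph \<theta>"
    and res: "z \<in> resolvent_set S (dom_L0 S)" and m: "multiplicity_of S (dom_L S \<theta>) z = 2"
  shows "degenerate_i S \<theta> z"
proof -
  let ?A = "qd0_b S (sol_u1 S z)" and ?B = "qd0_b S (sol_u2 S z)"
    and ?C = "qd1_b S (sol_u1 S z)" and ?D = "qd1_b S (sol_u2 S z)"
  obtain M where M: "hermitian_matrix M" "\<theta> = matrix_graph M"
    using \<theta>(2) unfolding is_hermitian_graph_def by blast
  have nz: "?B \<noteq> 0" by (rule resolvent_L0_denominator[OF res])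
  have "\<Gamma>1 S (comb z 1 0) = M *v \<Gamma>0 S (comb z 1 0)" "\<Gamma>1 S (comb z 0 1) = M *v \<Gamma>0 S (comb z 0 1)"
    using m multiplicity_eq_2_iff[OF \<theta>(1), of z]
    unfolding M(2) e_eq_comb comb_in_dom_L_graph by blast+
  then have eqs: "M $ 1 $ 1 + M $ 1 $ 2 * ?A = 0" "M $ 2 $ 1 + M $ 2 $ 2 * ?A = - ?C"
      "M $ 1 $ 2 * ?B = 1" "M $ 2 $ 2 * ?B = - ?D"
    by (simp_all add: \<Gamma>_comb vec_eq_iff forall_2 matrix_vector_mult_def sum_2)
  \<comment> \<open>The equations of u_2 give the second column; inserting it into those of u_1
    gives the first, the determinant producing the numerator 1.\<close>
  have "M $ 1 $ 1 * ?B = - ?A" "M $ 2 $ 1 * ?B = 1" using eqs fundamental_det[of z] by algebra+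
  with eqs nz have "M $ 1 $ 1 = - (?A / ?B)" "M $ 2 $ 1 = 1 / ?B" "M $ 2 $ 2 = - (?D / ?B)"
    by (simp_all add: nonzero_eq_divide_eq nonzero_neg_divide_eq_eq2)
  with M res show ?thesis unfolding degenerate_i_def by blast
qed

text \<open>In the primed boundary values the roles are exchanged: u_1 determines the second column,
  and u_2 then the first.\<close>

lemma multiplicity_2_imp_degenerate_ii:
  assumes \<theta>: "selfadjoint_relation \<theta>" and \<theta>': "\<theta>' = neg_rel_inverse \<theta>" "is_hermitian_graph \<theta>'"
    and res: "z \<in> resolvent_set S (dom_Linf S)" and m: "multiplicity_of S (dom_L S \<theta>) z = 2"
  shows "degenerate_ii S \<theta>' z"
proof -
  let ?A = "qd0_b S (sol_u1 S z)" and ?B = "qd0_b S (sol_u2 S z)"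
    and ?C = "qd1_b S (sol_u1 S z)" and ?D = "qd1_b S (sol_u2 S z)"
  obtain M where M: "hermitian_matrix M" "\<theta>' = matrix_graph M"
    using \<theta>'(2) unfolding is_hermitian_graph_def by blast
  have nz: "?C \<noteq> 0" by (rule resolvent_Linf_denominator[OF res])
  have "dom_L S \<theta> = dom_Ltilde S (matrix_graph M)"
    using dom_Ltilde_neg_rel_inverse[OF \<theta>] \<theta>'(1) M(2) by metis
  then have "\<Gamma>0 S (comb z 1 0) = M *v (- \<Gamma>1 S (comb z 1 0))" "\<Gamma>0 S (comb z 0 1) = M *v (- \<Gamma>1 S (comb z 0 1))"
    using m multiplicity_eq_2_iff[OF \<theta>, of z]
    unfolding e_eq_comb comb_in_dom_Ltilde_graph[symmetric] by simp_all
  then have eqs: "M $ 1 $ 2 * ?C = 1" "M $ 2 $ 2 * ?C = ?A"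
      "M $ 1 $ 2 * ?D - M $ 1 $ 1 = 0" "M $ 2 $ 2 * ?D - M $ 2 $ 1 = ?B"
    by (simp_all add: \<Gamma>_comb vec_eq_iff forall_2 matrix_vector_mult_def sum_2)
  have "M $ 1 $ 1 * ?C = ?D" "M $ 2 $ 1 * ?C = 1" using eqs fundamental_det[of z] by algebra+
  with eqs nz have "M $ 1 $ 1 = ?D / ?C" "M $ 2 $ 1 = 1 / ?C" "M $ 2 $ 2 = ?A / ?C"
    by (simp_all add: nonzero_eq_divide_eq)
  with M res show ?thesis unfolding degenerate_ii_def by blast
qed

end

theorem theorem3p11:
  fixes S :: sl_system and K \<mu> :: real and \<theta> \<theta>' :: relation2
  assumes "sl_coefficients S"
    and "limit_circle_a S" and "limit_circle_b S"
    and "Lmin_bounded_below S K"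
    and "boundary_solutions S" and "fundamental_solutions S"
    and "selfadjoint_relation \<theta>" and "selfadjoint_relation \<theta>'"
    and "\<theta>' = neg_rel_inverse \<theta>"
  shows "(degenerate S (dom_L S \<theta>) \<theta> \<theta>' \<mu> \<longrightarrow>
            multiplicity_of S (dom_L S \<theta>) (of_real \<mu>) = 2) \<and>
         (degenerate S (dom_Ltilde S \<theta>') \<theta> \<theta>' \<mu> \<longrightarrow>
            multiplicity_of S (dom_Ltilde S \<theta>') (of_real \<mu>) = 2) \<and>
         (K \<le> \<mu> \<and> of_real \<mu> \<in> resolvent_set S (dom_L0 S) \<and> is_hermitian_graph \<theta> \<and>
            eigenvalue S (dom_L S \<theta>) (of_real \<mu>) \<and>
            multiplicity_of S (dom_L S \<theta>) (of_real \<mu>) = 2 \<longrightarrow>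
            degenerate S (dom_L S \<theta>) \<theta> \<theta>' \<mu>) \<and>
         (K \<le> \<mu> \<and> of_real \<mu> \<in> resolvent_set S (dom_Linf S) \<and> is_hermitian_graph \<theta>' \<and>
            eigenvalue S (dom_Ltilde S \<theta>') (of_real \<mu>) \<and>
            multiplicity_of S (dom_Ltilde S \<theta>') (of_real \<mu>) = 2 \<longrightarrow>
            degenerate S (dom_Ltilde S \<theta>') \<theta> \<theta>' \<mu>)"
proof -
  interpret sl_bvp S using assms by unfold_locales
  \<comment> \<open>Both parametrisations describe one operator, so each implication is proved for
    \<open>dom_L S \<theta>\<close>.\<close>
  have dom: "dom_Ltilde S \<theta>' = dom_L S \<theta>"
    using dom_Ltilde_neg_rel_inverse[OF assms(7)] assms(9) by simp
  show ?thesis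
    unfolding dom
    using degenerate_imp_multiplicity_2[OF assms(7,9)]
      multiplicity_2_imp_degenerate_i[OF assms(7)]
      multiplicity_2_imp_degenerate_ii[OF assms(7,9)]
    unfolding degenerate_def by blast
qed

end
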